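(* Let $d\ge2$, let $\vec\mu=(\mu_1,\dots,\mu_d)$ be an Angelesco system, and let $\vec\kappa\in\mathbb R^d$ satisfy $\kappa_1+\cdots+\kappa_d=1$. Let $\mathcal J_{\vec\kappa}$ be the associated bounded self-adjoint Jacobi matrix on $\ell^2(\mathcal V)$, where $\mathcal V$ is the vertex set of the infinite rooted tree $\mathcal T$ with root $O$, and let $l(z)=(l_Y(z))_{Y\in\mathcal V}$ and $\gamma_1,\dots,\gamma_d$ be as in the context. Then $$l(z)=\Bigl(\sum_{j=1}^d\gamma_j\widehat\mu_j(z)\Bigr)(\mathcal J_{\vec\kappa}-z)^{-1}e_O$$ holds as an identity in the Hilbert space $\ell^2(\mathcal V)$ for all $z\notin\bigl(\bigcup_{j=1}^d\operatorname{supp}\mu_j\bigr)\cup\sigma(\mathcal J_{\vec\kappa})$. In particular, for such $z$ and every $Y\in\mathcal V$, $$G(Y,O,z)=\Bigl(\sum_{j=1}^d\gamma_j\widehat\mu_j(z)\Bigr)^{-1}l_Y(z),$$ where $G(Y,O,z)=\langle(\mathcal J_{\vec\kappa}-z)^{-1}e_O,e_Y\rangle$ is the Green's function of $\mathcal J_{\vec\kappa}$.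
   Context: Notation: $\mathbb N=\{1,2,\dots\}$, $\mathbb Z_+=\{0,1,\dots\}$, $|\vec n|=n_1+\cdots+n_d$, $\vec e_j$ standard basis vectors, $\vec1=(1,\dots,1)$; $\widehat\mu(z)=\int\frac{d\mu(x)}{z-x}$; $\sigma(\cdot)$ is the spectrum; $e_X$ is the function on $\mathcal V$ equal to $1$ at $X$ and $0$ elsewhere. Angelesco system: $\mu_1,\dots,\mu_d$ are positive finite Borel measures on $\mathbb R$ with infinite supports whose convex hulls of supports $\Delta_i$ are pairwise disjoint closed bounded segments, numbered so that $\Delta_1<\dots<\Delta_d$. Multiple orthogonal polynomials (well defined for Angelesco systems): $P_{\vec n}$ is the monic polynomial of degree $|\vec n|$ with $\int P_{\vec n}x^l\,d\mu_j=0$ for all $j$ and $0\le l\le n_j-1$. $A^{(j)}_{\vec n}$ are polynomials with $\deg A^{(j)}_{\vec n}\le n_j-1$ ($A^{(j)}_{\vec n}=0$ if $n_j=0$) such that $Q_{\vec n}:=\sum_jA^{(j)}_{\vec n}d\mu_j$ satisfies $\int x^lQ_{\vec n}(x)=0$ for $0\le l\le|\vec n|-2$ and $\int x^{|\vec n|-1}Q_{\vec n}(x)=1$. $L_{\vec n}(z):=\int\frac{Q_{\vec n}(x)}{z-x}$. Recurrence coefficients: real $a_{\vec n,j},b_{\vec n,j}$ uniquely determined by $xP_{\vec n}=P_{\vec n+\vec e_j}+b_{\vec n,j}P_{\vec n}+\sum_{l=1}^da_{\vec n,l}P_{\vec n-\vec e_l}$ ($\vec n\in\mathbb Z_+^d$,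 $1\le j\le d$; $P_{\vec n-\vec e_l}=0$ and $a_{\vec n,l}=0$ if a component of $\vec n-\vec e_l$ is negative). The same numbers satisfy $xQ_{\vec n}=Q_{\vec n-\vec e_j}+b_{\vec n-\vec e_j,j}Q_{\vec n}+\sum_{l=1}^da_{\vec n,l}Q_{\vec n+\vec e_l}$ for $\vec n\in\mathbb N^d$. For Angelesco systems $a_{\vec n,j}>0$ when $n_j>0$, and these coefficients are bounded over $\vec n\in\mathbb N^d$, $1\le j\le d$. Tree: $\mathcal T$ is the infinite rooted tree in which each vertex $Y$ has exactly $d$ children $Y_{(ch),1},\dots,Y_{(ch),d}$; $O$ is the root and $Y_{(p)}$ is the parent of $Y\ne O$. $\Pi:\mathcal V\to\mathbb N^d$ is given by $\Pi(O)=\vec1$, $\Pi(Y_{(ch),l})=\Pi(Y)+\vec e_l$. For $Y\neq O$, $\tilde\ell_Y$ is the index with $\Pi(Y)=\Pi(Y_{(p)})+\vec e_{\tilde\ell_Y}$ (so $\tilde\ell_{Y}=l$ if $Y$ is the $l$-th child of its parent). Operator: $\widetilde V_Y:=b_{\Pi(Y_{(p)}),\tilde\ell_Y}$, $\widetilde W_Y:=a_{\Pi(Y_{(p)}),\tilde\ell_Y}$ for $Y\ne O$; $\widetilde V_O:=\sum_{j=1}^d\kappa_jb_{\vec1-\vec e_j,j}$, $\widetilde W_O:=1$. Then $$(\mathcal J_{\vec\kappa}f)_Y=\widetilde W_Y^{1/2}f_{Y_{(p)}}+\widetilde V_Yf_Y+\sum_{i=1}^d\widetilde W_{Y_{(ch),i}}^{1/2}f_{Y_{(ch),i}}\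 (Y\ne O),\qquad(\mathcal J_{\vec\kappa}f)_O=\widetilde V_Of_O+\sum_{i=1}^d\widetilde W_{O_{(ch),i}}^{1/2}f_{O_{(ch),i}}.$$ $m_Y:=\prod_{y\in\mathrm{path}(Y,O)}\widetilde W_y^{-1/2}$ (product over the non-self-intersecting path from $Y$ to $O$, endpoints included), and $l_Y(z):=m_Y^{-1}L_{\Pi(Y)}(z)$. Constants: $\gamma_i:=-\sum_{j=1}^d\kappa_jA^{(i)}_{\vec1-\vec e_j}$. Here $A^{(i)}_{\vec1-\vec e_j}$, $i=1,\dots,d$, are constants with $A^{(j)}_{\vec1-\vec e_j}=0$, determined by $\sum_iA^{(i)}_{\vec1-\vec e_j}\int t^l\,d\mu_i(t)=0$ for $0\le l\le d-3$ and $\sum_iA^{(i)}_{\vec1-\vec e_j}\int t^{d-2}\,d\mu_i(t)=1$. *)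

theory Defs
  imports
    "HOL-Analysis.Analysis"
    "HOL-Computational_Algebra.Polynomial"
    "HOL-Library.Sublist"
begin

section \<open>Angelesco systems\<close>

definition msupport :: "real measure \<Rightarrow> real set" where
  "msupport M = {x. \<forall>e>0. measure M (ball x e) > 0}"

text \<open>
  The index set \<open>{1,\<dots>,d}\<close> is a finite linearly ordered type \<open>'d\<close> with \<open>CARD('d) = d\<close>; the order
  is the numbering of the intervals from left to right (which makes them pairwise disjoint).
\<close>

definition angelesco :: "('d::{finite,linorder} \<Rightarrow> real measure) \<Rightarrow> bool" where
  "angelesco \<mu> \<longleftrightarrow>
     (\<forall>i. finite_measure (\<mu> i) \<and> sets (\<mu> i) = sets borel \<and> infinite (msupport (\<mu> i)) \<and>
          (\<exists>a b. convex hull (msupport (\<mu> i)) = {a..b})) \<and>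
     (\<forall>i j. i < j \<longrightarrow>
        (\<forall>x \<in> convex hull (msupport (\<mu> i)). \<forall>y \<in> convex hull (msupport (\<mu> j)). x < y))"

definition markov_fun :: "real measure \<Rightarrow> complex \<Rightarrow> complex" where
  "markov_fun M z = (LINT x|M. 1 / (z - complex_of_real x))"


section \<open>Multiple orthogonal polynomials\<close>

text \<open>
  Multi-indices are vectors \<open>n :: nat ^ 'd\<close>; \<open>axis j 1\<close> is the \<open>j\<close>-th standard basis vector and
  \<open>1\<close> is the vector all of whose components are \<open>1\<close>. Subtraction is componentwise and truncated,
  so \<open>n - axis j 1\<close> is only meaningful if \<open>n $ j > 0\<close>.
\<close>

definition msize :: "nat ^ 'd \<Rightarrow> nat" where
  "msize n = (\<Sum>j\<in>UNIV. n $ j)"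

definition mop_II :: "('d::finite \<Rightarrow> real measure) \<Rightarrow> nat ^ 'd \<Rightarrow> real poly" where
  "mop_II \<mu> n = (THE p. degree p = msize n \<and> lead_coeff p = 1 \<and>
     (\<forall>j. \<forall>l < n $ j. (LINT x|\<mu> j. poly p x * x ^ l) = 0))"

text \<open>
  \<open>mop_I \<mu> n j\<close> is the polynomial \<open>A\<^bsub>n\<^esub>\<^bsup>(j)\<^esup>\<close>, for \<open>n \<noteq> 0\<close>. The range \<open>0 \<le> l \<le> |n| - 2\<close>, empty
  for \<open>|n| = 1\<close>, is written \<open>l + 2 \<le> |n|\<close>.
\<close>

definition mop_I :: "('d::finite \<Rightarrow> real measure) \<Rightarrow> nat ^ 'd \<Rightarrow> 'd \<Rightarrow> real poly" where
  "mop_I \<mu> n = (THE A.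
     (\<forall>j. if n $ j = 0 then A j = 0 else degree (A j) \<le> n $ j - 1) \<and>
     (\<forall>l. l + 2 \<le> msize n \<longrightarrow> (\<Sum>j\<in>UNIV. LINT x|\<mu> j. x ^ l * poly (A j) x) = 0) \<and>
     (\<Sum>j\<in>UNIV. LINT x|\<mu> j. x ^ (msize n - 1) * poly (A j) x) = 1)"

definition L_fun :: "('d::finite \<Rightarrow> real measure) \<Rightarrow> nat ^ 'd \<Rightarrow> complex \<Rightarrow> complex" where
  "L_fun \<mu> n z =
     (\<Sum>j\<in>UNIV. LINT x|\<mu> j. complex_of_real (poly (mop_I \<mu> n j) x) / (z - complex_of_real x))"

definition is_rec_coeffs ::
  "('d::finite \<Rightarrow> real measure) \<Rightarrow> (nat ^ 'd \<Rightarrow> 'd \<Rightarrow> real) \<times> (nat ^ 'd \<Rightarrow> 'd \<Rightarrow> real) \<Rightarrow> bool" where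
  "is_rec_coeffs \<mu> = (\<lambda>(a, b).
     (\<forall>n l. n $ l = 0 \<longrightarrow> a n l = 0) \<and>
     (\<forall>n j. [:0, 1:] * mop_II \<mu> n =
        mop_II \<mu> (n + axis j 1) + smult (b n j) (mop_II \<mu> n) +
        (\<Sum>l\<in>UNIV. if n $ l = 0 then 0 else smult (a n l) (mop_II \<mu> (n - axis l 1)))))"

definition rec_a :: "('d::finite \<Rightarrow> real measure) \<Rightarrow> nat ^ 'd \<Rightarrow> 'd \<Rightarrow> real" where
  "rec_a \<mu> = fst (THE ab. is_rec_coeffs \<mu> ab)"

definition rec_b :: "('d::finite \<Rightarrow> real measure) \<Rightarrow> nat ^ 'd \<Rightarrow> 'd \<Rightarrow> real" where
  "rec_b \<mu> = snd (THE ab. is_rec_coeffs \<mu> ab)"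

text \<open>\<open>A\<^bsub>n\<^esub>\<^bsup>(i)\<^esup>\<close> is constant for \<open>n = 1 - axis j 1\<close>, hence equal to its coefficient of order \<open>0\<close>.\<close>

definition gamma_const :: "('d::finite \<Rightarrow> real measure) \<Rightarrow> real ^ 'd \<Rightarrow> 'd \<Rightarrow> real" where
  "gamma_const \<mu> \<kappa> i = - (\<Sum>j\<in>UNIV. \<kappa> $ j * coeff (mop_I \<mu> (1 - axis j 1) i) 0)"


section \<open>The Jacobi matrix on the rooted tree\<close>

text \<open>
  A vertex of the infinite rooted \<open>d\<close>-ary tree is a list over \<open>'d\<close>: the root is \<open>[]\<close> and the
  \<open>l\<close>-th child of \<open>Y\<close> is \<open>l # Y\<close>. The path from \<open>Y\<close> to the root thus consists of the suffixes
  of \<open>Y\<close>.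
\<close>

fun tree_proj :: "'d list \<Rightarrow> nat ^ 'd" where
  "tree_proj [] = 1"
| "tree_proj (l # Y) = tree_proj Y + axis l 1"

fun pot_V :: "('d::finite \<Rightarrow> real measure) \<Rightarrow> real ^ 'd \<Rightarrow> 'd list \<Rightarrow> real" where
  "pot_V \<mu> \<kappa> [] = (\<Sum>j\<in>UNIV. \<kappa> $ j * rec_b \<mu> (1 - axis j 1) j)"
| "pot_V \<mu> \<kappa> (l # Y) = rec_b \<mu> (tree_proj Y) l"

fun weight_W :: "('d::finite \<Rightarrow> real measure) \<Rightarrow> 'd list \<Rightarrow> real" where
  "weight_W \<mu> [] = 1"
| "weight_W \<mu> (l # Y) = rec_a \<mu> (tree_proj Y) l"

fun jacobi :: "('d::finite \<Rightarrow> real measure) \<Rightarrow> real ^ 'd \<Rightarrow> ('d list \<Rightarrow> complex) \<Rightarrow> 'd list \<Rightarrow> complex" where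
  "jacobi \<mu> \<kappa> f [] =
     of_real (pot_V \<mu> \<kappa> []) * f [] +
     (\<Sum>i\<in>UNIV. of_real (sqrt (weight_W \<mu> [i])) * f [i])"
| "jacobi \<mu> \<kappa> f (l # Y) =
     of_real (sqrt (weight_W \<mu> (l # Y))) * f Y + of_real (pot_V \<mu> \<kappa> (l # Y)) * f (l # Y) +
     (\<Sum>i\<in>UNIV. of_real (sqrt (weight_W \<mu> (i # l # Y))) * f (i # l # Y))"

definition m_const :: "('d::finite \<Rightarrow> real measure) \<Rightarrow> 'd list \<Rightarrow> real" where
  "m_const \<mu> Y = (\<Prod>y \<in> {y. suffix y Y}. 1 / sqrt (weight_W \<mu> y))"

definition l_fun :: "('d::finite \<Rightarrow> real measure) \<Rightarrow> complex \<Rightarrow> 'd list \<Rightarrow> complex" where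
  "l_fun \<mu> z Y = L_fun \<mu> (tree_proj Y) z / of_real (m_const \<mu> Y)"


section \<open>The Hilbert space of square-summable functions and its operators\<close>

definition ell2 :: "('v \<Rightarrow> complex) set" where
  "ell2 = {f. (\<lambda>v. (cmod (f v))\<^sup>2) summable_on UNIV}"

definition ell2_norm :: "('v \<Rightarrow> complex) \<Rightarrow> real" where
  "ell2_norm f = sqrt (\<Sum>\<^sub>\<infinity>v. (cmod (f v))\<^sup>2)"

definition ell2_inner :: "('v \<Rightarrow> complex) \<Rightarrow> ('v \<Rightarrow> complex) \<Rightarrow> complex" where
  "ell2_inner f g = (\<Sum>\<^sub>\<infinity>v. f v * cnj (g v))"

definition ell2_delta :: "'v \<Rightarrow> 'v \<Rightarrow> complex" where
  "ell2_delta X v = (if v = X then 1 else 0)"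

definition shift_op :: "(('v \<Rightarrow> complex) \<Rightarrow> 'v \<Rightarrow> complex) \<Rightarrow> complex \<Rightarrow> ('v \<Rightarrow> complex) \<Rightarrow> 'v \<Rightarrow> complex" where
  "shift_op T z f = (\<lambda>v. T f v - z * f v)"

definition resolvent :: "(('v \<Rightarrow> complex) \<Rightarrow> 'v \<Rightarrow> complex) \<Rightarrow> complex \<Rightarrow> ('v \<Rightarrow> complex) \<Rightarrow> 'v \<Rightarrow> complex" where
  "resolvent T z = inv_into ell2 (shift_op T z)"

text \<open>
  The spectrum of \<open>T\<close> as a linear operator on \<open>ell2\<close>: \<open>z\<close> is outside the spectrum iff \<open>T - z\<close> is
  a bijection of \<open>ell2\<close> onto itself with bounded inverse.
\<close>

definition ell2_spectrum :: "(('v \<Rightarrow> complex) \<Rightarrow> 'v \<Rightarrow> complex) \<Rightarrow> complex set" where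
  "ell2_spectrum T = - {z. bij_betw (shift_op T z) ell2 ell2 \<and>
     (\<exists>C. \<forall>f\<in>ell2. ell2_norm (resolvent T z f) \<le> C * ell2_norm f)}"

definition green :: "(('v \<Rightarrow> complex) \<Rightarrow> 'v \<Rightarrow> complex) \<Rightarrow> 'v \<Rightarrow> 'v \<Rightarrow> complex \<Rightarrow> complex" where
  "green T Y X z = ell2_inner (resolvent T z (ell2_delta X)) (ell2_delta Y)"

end

theory Submission
  imports Defs
begin

text \<open>
  The nearest-neighbour recurrence for the type I functions says that \<open>l(z)\<close> solves
  \<open>(J - z) l = S e\<^sub>O\<close> coordinatewise, so outside the spectrum only \<open>l(z) \<in> \<ell>\<^sup>2\<close> and \<open>S(z) \<noteq> 0\<close> remain.
  Both follow from counting sign changes of linear forms in the \<open>\<mu>\<^sub>j\<close>. For nonreal \<open>z\<close> no real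
  combination of \<open>L\<close> at \<open>n\<close> and at \<open>n + e\<^sub>i\<close> vanishes at \<open>z\<close>, so the quotient of the two maps the
  upper half-plane to the lower one; hence the flux in Green's identity on balls of the tree has
  a sign and the partial sums of \<open>|l\<^sub>Y(z)|\<^sup>2\<close> are bounded, without any bound on the recurrence
  coefficients. Real \<open>z\<close> outside the spectrum are reached as limits of nonreal points, using that the
  resolvent at \<open>z\<close> is bounded. If \<open>S(z) = 0\<close>, then \<open>l(z) = 0\<close>, so two neighbouring \<open>L\<close> would have the
  common zero \<open>z\<close>, which the sign-change count excludes as well.
\<close>

text \<open>The coordinate equations do not determine l(z): on a tree with at least two children per
  vertex they leave infinitely many free values, so injectivity of J - z can be used only once
  membership in \<open>ell2\<close> is known. Every sign count runs on a degree budget. A nonzero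
  form A for the index n has a polynomial P of degree at most |n| - 1 with all A_j P nonnegative on
  the intervals, so it cannot annihilate P, not even after insertion of a positive weight. A
  combination of the forms at n and n + e_i is only known to annihilate degrees up to |n| - 2, while
  P may have degree |n|. The two missing degrees come from the Cauchy kernel: if the transform of a
  form vanishes at z, division by z - x gains one degree. At nonreal z one division is enough, since
  the remaining defect is a real number and the positive weight is read off from the imaginary part
  of 1/(z - x). At real z there is no imaginary part; hence two divisions, and the weight 1/(z -
  x)^2.\<close>

section \<open>Compactly supported measures on the line\<close>

lemma cauchy_kernel_measurable:
  "(\<lambda>x. complex_of_real (poly p x) / (z - complex_of_real x) ^ m) \<in> borel_measurable borel"
proof -
  have [measurable]: "poly p \<in> borel_measurable borel"
    by (auto intro!: borel_measurable_continuous_onI continuous_intros)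
  show ?thesis by measurable
qed

locale compact_borel_measure = finite_measure M for M :: "real measure" +
  assumes sets_eq_borel: "sets M = sets borel"
    and bounded_msupport: "bounded (msupport M)"
    and infinite_msupport: "infinite (msupport M)"
begin

lemma not_in_msupport_iff: "x \<notin> msupport M \<longleftrightarrow> (\<exists>e>0. measure M (ball x e) = 0)"
  unfolding msupport_def by (auto simp: zero_less_measure_iff)

lemma closed_msupport: "closed (msupport M)"
  unfolding closed_def open_contains_ball
proof (intro ballI)
  fix x assume "x \<in> - msupport M"
  then obtain e where e: "e > 0" "measure M (ball x e) = 0"
    using not_in_msupport_iff by auto
  have "ball x e \<subseteq> - msupport M"
  proof
    fix y assume y: "y \<in> ball x e"
    then obtain e' where e': "e' > 0" "ball y e' \<subseteq> ball x e"
      using open_ball open_contains_ball by metis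
    have "measure M (ball y e') \<le> measure M (ball x e)"
      by (rule finite_measure_mono) (use e' in \<open>auto simp: sets_eq_borel\<close>)
    then have "measure M (ball y e') = 0"
      using e measure_nonneg[of M "ball y e'"] by linarith
    then show "y \<in> - msupport M"
      using e' not_in_msupport_iff by auto
  qed
  then show "\<exists>e>0. ball x e \<subseteq> - msupport M" using e by auto
qed

lemma compact_msupport: "compact (msupport M)"
  using closed_msupport bounded_msupport by (simp add: compact_eq_bounded_closed)

text \<open>By the Lindelof property countably many null balls cover the complement of the
  support.\<close>

lemma AE_msupport: "AE x in M. x \<in> msupport M"
proof -
  define F where "F = {ball x e | x e. e > 0 \<and> measure M (ball x e) = 0}"
  have "\<And>S. S \<in> F \<Longrightarrow> open S" by (auto simp: F_def)
  then obtain F' where F': "F' \<subseteq> F" "countable F'" "\<Union> F' = \<Union> F"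
    using Lindelof[of F] by metis
  have "- msupport M \<subseteq> \<Union> F"
    using not_in_msupport_iff by (force simp: F_def)
  moreover have "(\<Union>S\<in>F'. S) \<in> null_sets M"
  proof (rule null_sets_UN'[OF \<open>countable F'\<close>])
    fix S assume "S \<in> F'"
    then show "S \<in> null_sets M"
      using F'(1) by (auto simp: F_def null_sets_def sets_eq_borel emeasure_eq_measure)
  qed
  ultimately have "\<Union> F' \<in> null_sets M" "{x \<in> space M. x \<notin> msupport M} \<subseteq> \<Union> F'"
    using F' by auto
  then show ?thesis by (rule AE_I')
qed

lemma integrable_continuous_on_msupport:
  fixes f :: "real \<Rightarrow> 'b::{banach, second_countable_topology}"
  assumes "f \<in> borel_measurable borel" "continuous_on (msupport M) f"
  shows "integrable M f"
proof -
  have "bounded (f ` msupport M)"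
    using assms compact_msupport compact_continuous_image compact_imp_bounded by blast
  then obtain B where B: "\<And>x. x \<in> msupport M \<Longrightarrow> norm (f x) \<le> B"
    unfolding bounded_iff by auto
  show ?thesis
    by (rule integrable_const_bound[where B = B])
      (use AE_msupport B assms(1) measurable_cong_sets[OF sets_eq_borel refl] in \<open>auto elim: eventually_mono\<close>)
qed

lemma integrable_poly: "integrable M (poly p)"
  by (rule integrable_continuous_on_msupport)
    (auto intro!: continuous_intros borel_measurable_continuous_onI)

text \<open>If the integral vanished, p would be zero almost everywhere, hence by continuity on the
  whole support, which has more points than a nonzero polynomial has zeros. The weights used later
  are 1 and 1/|z - x|^2.\<close>

lemma integral_poly_weight_pos:
  assumes "p \<noteq> 0" and nn: "\<And>x. x \<in> msupport M \<Longrightarrow> poly p x \<ge> 0"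
    and w: "\<And>x. x \<in> msupport M \<Longrightarrow> w x > 0"
    and int: "integrable M (\<lambda>x. poly p x * w x)"
  shows "(LINT x|M. poly p x * w x) > 0"
proof -
  have nonneg: "AE x in M. 0 \<le> poly p x * w x"
    using AE_msupport by eventually_elim (use nn w in \<open>simp add: less_imp_le\<close>)
  have "(LINT x|M. poly p x * w x) \<noteq> 0"
  proof
    assume "(LINT x|M. poly p x * w x) = 0"
    then have "AE x in M. poly p x * w x = 0"
      using integral_nonneg_eq_0_iff_AE[OF int nonneg] by simp
    with AE_msupport have ae: "AE x in M. poly p x = 0"
      by eventually_elim (use w in force)
    have "msupport M \<subseteq> {x. poly p x = 0}"
    proof (rule ccontr)
      assume "\<not> ?thesis"
      then obtain x where x: "x \<in> msupport M" "poly p x \<noteq> 0" by auto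
      have "open {x. poly p x \<noteq> 0}"
        by (intro open_Collect_neq continuous_intros)
      then obtain e where e: "e > 0" "ball x e \<subseteq> {x. poly p x \<noteq> 0}"
        using x(2) open_contains_ball by blast
      have "measure M (ball x e) = 0"
      proof -
        have "AE y in M. y \<notin> ball x e"
          using ae by eventually_elim (use e in auto)
        moreover have "{y \<in> space M. \<not> y \<notin> ball x e} = ball x e"
          using sets_eq_imp_space_eq[OF sets_eq_borel] by auto
        ultimately have "emeasure M (ball x e) = 0"
          using AE_iff_measurable[of "ball x e" M "\<lambda>y. y \<notin> ball x e"] sets_eq_borel by simp
        then show ?thesis by (simp add: emeasure_eq_measure)
      qed
      then show False using x e by (auto simp: msupport_def)
    qed
    then show False
      using infinite_msupport poly_roots_finite[OF \<open>p \<noteq> 0\<close>] finite_subset by blast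
  qed
  moreover have "(LINT x|M. poly p x * w x) \<ge> 0"
    by (rule integral_nonneg_AE) (rule nonneg)
  ultimately show ?thesis by linarith
qed

lemma isCont_cauchy:
  assumes z: "z \<notin> complex_of_real ` msupport M"
  shows "isCont (\<lambda>z. LINT x|M. complex_of_real (poly p x) / (z - complex_of_real x)) z"
  unfolding continuous_at_sequentially
proof (intro allI impI)
  fix u :: "nat \<Rightarrow> complex" assume u: "u \<longlonglongrightarrow> z"
  have "compact (complex_of_real ` msupport M)"
    by (intro compact_continuous_image compact_msupport continuous_intros)
  then obtain e where e: "e > 0" "\<And>y. y \<in> complex_of_real ` msupport M \<Longrightarrow> e \<le> dist z y"
    using separate_point_closed[OF compact_imp_closed z] by blast
  \<comment> \<open>Within half the distance e of z to the support, |u n - x| stays above e/2, which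
    yields the dominating function.\<close>
  obtain N where N: "\<And>n. n \<ge> N \<Longrightarrow> dist (u n) z < e / 2"
    using u e(1) unfolding lim_sequentially by (meson half_gt_zero)
  have "(\<lambda>n. LINT x|M. complex_of_real (poly p x) / (u (n + N) - complex_of_real x))
      \<longlonglongrightarrow> (LINT x|M. complex_of_real (poly p x) / (z - complex_of_real x))"
  proof (rule integral_dominated_convergence)
    show "integrable M (\<lambda>x. \<bar>poly p x\<bar> * (2 / e))"
      by (intro integrable_mult_left integrable_abs integrable_poly)
    show "AE x in M. (\<lambda>n. complex_of_real (poly p x) / (u (n + N) - complex_of_real x))
        \<longlonglongrightarrow> complex_of_real (poly p x) / (z - complex_of_real x)"
      using AE_msupport
    proof eventually_elim
      case (elim x)
      then have "z \<noteq> complex_of_real x" using z by auto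
      then show ?case
        by (intro tendsto_intros LIMSEQ_ignore_initial_segment u) auto
    qed
    show "AE x in M. norm (complex_of_real (poly p x) / (u (n + N) - complex_of_real x))
        \<le> \<bar>poly p x\<bar> * (2 / e)" for n
      using AE_msupport
    proof eventually_elim
      case (elim x)
      have "e \<le> dist z (complex_of_real x)" using e elim by auto
      also have "\<dots> \<le> dist z (u (n + N)) + dist (u (n + N)) (complex_of_real x)"
        by (rule dist_triangle)
      finally have "e / 2 \<le> cmod (u (n + N) - complex_of_real x)"
        using N[of "n + N"] by (simp add: dist_norm norm_minus_commute)
      then have "\<bar>poly p x\<bar> / cmod (u (n + N) - complex_of_real x) \<le> \<bar>poly p x\<bar> / (e / 2)"
        using e(1) by (intro divide_left_mono mult_pos_pos) auto
      then show ?case by (simp add: norm_divide)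
    qed
  qed (simp_all add: cauchy_kernel_measurable[where m = 1, simplified] measurable_cong_sets[OF sets_eq_borel refl])
  then show "((\<lambda>z. LINT x|M. complex_of_real (poly p x) / (z - complex_of_real x)) \<circ> u)
      \<longlonglongrightarrow> (LINT x|M. complex_of_real (poly p x) / (z - complex_of_real x))"
    unfolding comp_def by (rule LIMSEQ_offset)
qed

end

section \<open>Real polynomials of constant sign on intervals\<close>

lemma poly_const_sign:
  fixes p :: "real poly"
  assumes "\<And>x. x \<in> {a..b} \<Longrightarrow> poly p x \<noteq> 0"
  shows "\<exists>\<epsilon>::real. (\<epsilon> = 1 \<or> \<epsilon> = -1) \<and> (\<forall>x\<in>{a..b}. \<epsilon> * poly p x > 0)"
proof (cases "a \<le> b")
  case True
  define \<epsilon> where "\<epsilon> = sgn (poly p a)"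
  have a: "poly p a \<noteq> 0" using assms True by auto
  show ?thesis
  proof (intro exI[of _ \<epsilon>] conjI ballI)
    show "\<epsilon> = 1 \<or> \<epsilon> = -1" using a by (auto simp: \<epsilon>_def sgn_real_def)
    fix x assume x: "x \<in> {a..b}"
    show "\<epsilon> * poly p x > 0"
    proof (rule ccontr)
      assume "\<not> \<epsilon> * poly p x > 0"
      then have neg: "poly (smult \<epsilon> p) x \<le> 0" by simp
      have pos: "poly (smult \<epsilon> p) a \<ge> 0" by (simp add: \<epsilon>_def sgn_real_def)
      obtain y where y: "a \<le> y" "y \<le> x" "poly (smult \<epsilon> p) y = 0"
        using IVT2'[of "poly (smult \<epsilon> p)" x 0 a, OF neg pos _ continuous_on_poly[OF continuous_on_id]] x
        by auto
      have "\<epsilon> \<noteq> 0" using a by (simp add: \<epsilon>_def sgn_zero_iff)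
      then have "poly p y = 0" using y by simp
      then show False using assms[of y] x y by simp
    qed
  qed
qed (auto intro!: exI[of _ 1])

text \<open>\<open>S\<close> collects the interior zeros of odd multiplicity, where p changes sign.
  Even powers and powers belonging to zeros at the endpoints keep their sign on the interval and go
  into \<open>r\<close>. The induction removes a zero with its full multiplicity, so that it cannot
  recur in \<open>S\<close>.\<close>

lemma poly_sign_split:
  fixes p :: "real poly"
  assumes "p \<noteq> 0"
  shows "\<exists>S r \<epsilon>. finite S \<and> S \<subseteq> {a<..<b} \<and> p = (\<Prod>s\<in>S. [:-s, 1:]) * r \<and>
    (\<epsilon> = 1 \<or> \<epsilon> = (-1::real)) \<and> (\<forall>x\<in>{a..b}. \<epsilon> * poly r x \<ge> 0)"
  using assms
proof (induction "degree p" arbitrary: p rule: less_induct)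
  case less
  show ?case
  proof (cases "\<exists>s\<in>{a..b}. poly p s = 0")
    case False
    then obtain \<epsilon> :: real where "\<epsilon> = 1 \<or> \<epsilon> = -1" "\<forall>x\<in>{a..b}. \<epsilon> * poly p x > 0"
      using poly_const_sign[of a b p] by blast
    then show ?thesis
      by (intro exI[of _ "{}"] exI[of _ p] exI[of _ \<epsilon>]) (auto intro: less_imp_le)
  next
    case True
    then obtain s where s: "s \<in> {a..b}" "poly p s = 0" by auto
    define k where "k = order s p"
    obtain p' where p': "p = [:-s, 1:] ^ k * p'" "\<not> [:-s, 1:] dvd p'"
      using order_decomp[OF \<open>p \<noteq> 0\<close>] k_def by metis
    have "k > 0" using s \<open>p \<noteq> 0\<close> by (simp add: k_def order_root)
    have "p' \<noteq> 0" using \<open>p \<noteq> 0\<close> p' by auto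
    then have "degree p = k + degree p'"
      using p' by (simp add: degree_mult_eq degree_power_eq)
    with \<open>k > 0\<close> \<open>p' \<noteq> 0\<close> less obtain S r \<epsilon> where
      S: "finite S" "S \<subseteq> {a<..<b}" "p' = (\<Prod>s\<in>S. [:-s, 1:]) * r"
      and \<epsilon>: "\<epsilon> = 1 \<or> \<epsilon> = (-1::real)" "\<forall>x\<in>{a..b}. \<epsilon> * poly r x \<ge> 0"
      by (metis less_add_same_cancel2)
    have "s \<notin> S"
      using p'(2) S by (auto simp: poly_eq_0_iff_dvd[symmetric] poly_prod)
    have pull: "\<epsilon> * poly ([:-s, 1:] ^ i * r) x = (x - s) ^ i * (\<epsilon> * poly r x)" for i x
      by (simp add: poly_power mult_ac)
    consider "even k" | "odd k" "a < s" "s < b" | "s = a" | "s = b"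
      using s by fastforce
    then show ?thesis
    proof cases
      case 1
      then have "\<forall>x\<in>{a..b}. \<epsilon> * poly ([:-s, 1:] ^ k * r) x \<ge> 0"
        unfolding pull using \<epsilon> by (blast intro: mult_nonneg_nonneg zero_le_even_power)
      moreover have "p = (\<Prod>s\<in>S. [:-s, 1:]) * ([:-s, 1:] ^ k * r)"
        using S p' by (simp add: algebra_simps)
      ultimately show ?thesis using S \<epsilon>(1) by blast
    next
      case 2
      then have ev: "even (k - 1)" and kk: "[:-s, 1:] ^ k = [:-s, 1:] * [:-s, 1:] ^ (k - 1)"
        using \<open>k > 0\<close> by (auto simp: power_eq_if)
      have "\<forall>x\<in>{a..b}. \<epsilon> * poly ([:-s, 1:] ^ (k - 1) * r) x \<ge> 0"
        unfolding pull using \<epsilon> ev by (blast intro: mult_nonneg_nonneg zero_le_even_power)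
      moreover have "p = (\<Prod>s\<in>insert s S. [:-s, 1:]) * ([:-s, 1:] ^ (k - 1) * r)"
        unfolding prod.insert[OF S(1) \<open>s \<notin> S\<close>] p'(1) kk S(3) by (simp only: mult_ac)
      moreover have "finite (insert s S)" "insert s S \<subseteq> {a<..<b}" using S 2 by auto
      ultimately show ?thesis using \<epsilon>(1) by blast
    next
      case 3
      then have "\<forall>x\<in>{a..b}. \<epsilon> * poly ([:-s, 1:] ^ k * r) x \<ge> 0"
        unfolding pull using \<epsilon> by (auto intro!: mult_nonneg_nonneg)
      moreover have "p = (\<Prod>s\<in>S. [:-s, 1:]) * ([:-s, 1:] ^ k * r)"
        using S p' by (simp add: algebra_simps)
      ultimately show ?thesis using S \<epsilon>(1) by blast
    next
      case 4
      \<comment> \<open>To the left of b the factor (x - b)^k has the sign (-1)^k, which is absorbed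
        into the sign of the cofactor.\<close>
      have "\<forall>x\<in>{a..b}. ((-1) ^ k * \<epsilon>) * poly ([:-s, 1:] ^ k * r) x \<ge> 0"
      proof
        fix x assume x: "x \<in> {a..b}"
        have "((-1) ^ k * \<epsilon>) * poly ([:-s, 1:] ^ k * r) x = (s - x) ^ k * (\<epsilon> * poly r x)"
          by (simp add: poly_power mult_ac flip: power_mult_distrib)
        also have "\<dots> \<ge> 0" using \<epsilon>(2) 4 x by (intro mult_nonneg_nonneg[OF zero_le_power]) (simp, blast)
        finally show "((-1) ^ k * \<epsilon>) * poly ([:-s, 1:] ^ k * r) x \<ge> 0" .
      qed
      moreover have "(-1) ^ k * \<epsilon> = 1 \<or> (-1) ^ k * \<epsilon> = -1"
        using \<epsilon>(1) by (cases "even k") auto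
      moreover have "p = (\<Prod>s\<in>S. [:-s, 1:]) * ([:-s, 1:] ^ k * r)"
        using S p' by (simp add: algebra_simps)
      ultimately show ?thesis using S by blast
    qed
  qed
qed

lemma degree_prod_linear_factors: "degree (\<Prod>s\<in>S. [:-s, 1::'a::idom:]) = card S"
  by (cases "finite S") (simp_all add: degree_prod_eq_sum_degree)

lemma prod_linear_factors_dvd:
  fixes p :: "'a::idom poly"
  assumes "finite S" "\<And>s. s \<in> S \<Longrightarrow> poly p s = 0"
  shows "(\<Prod>s\<in>S. [:-s, 1:]) dvd p"
  using assms
proof (induction S rule: finite_induct)
  case (insert s S)
  then obtain r where r: "p = (\<Prod>s\<in>S. [:-s, 1:]) * r" by (auto elim: dvdE)
  have "poly (\<Prod>s\<in>S. [:-s, 1:]) s \<noteq> 0"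
    using insert by (auto simp: poly_prod)
  then have "[:-s, 1:] dvd r"
    using insert.prems[of s] r by (auto simp: poly_eq_0_iff_dvd[symmetric])
  then have "(\<Prod>s\<in>S. [:-s, 1:]) * [:-s, 1:] dvd p"
    unfolding r by (rule mult_dvd_mono[OF dvd_refl])
  then show ?case
    unfolding prod.insert[OF insert.hyps] by (simp only: mult.commute)
qed auto

section \<open>Angelesco systems and sign patterns\<close>

locale angelesco_system =
  fixes \<mu> :: "'d::{finite,linorder} \<Rightarrow> real measure" and lo hi :: "'d \<Rightarrow> real"
  assumes compact_borel: "\<And>j. compact_borel_measure (\<mu> j)"
    and msupport_hull: "\<And>j. msupport (\<mu> j) \<subseteq> {lo j..hi j}"
    and ordered: "\<And>i j. i < j \<Longrightarrow> hi i < lo j"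
begin

sublocale meas: compact_borel_measure "\<mu> j" for j
  by (rule compact_borel)

lemma lo_le_hi: "lo j \<le> hi j"
proof -
  have "msupport (\<mu> j) \<noteq> {}" using meas.infinite_msupport[of j] by auto
  then show ?thesis using msupport_hull[of j] by fastforce
qed

lemma disjoint_hulls: "x \<in> {lo i..hi i} \<Longrightarrow> x \<in> {lo j..hi j} \<Longrightarrow> i = j"
  using ordered[of i j] ordered[of j i] by (cases i j rule: linorder_cases) auto

text \<open>Intervals are added from left to right, and a zero is spent only in a gap where the
  prescribed sign flips; hence the degree bound. The last conjunct is the strengthening that the
  induction needs: it fixes the sign of R on the next interval.\<close>

lemma sign_pattern_poly:
  fixes \<epsilon> :: "'d \<Rightarrow> real"
  assumes "finite J" "J \<noteq> {}" "\<And>j. j \<in> J \<Longrightarrow> \<epsilon> j = 1 \<or> \<epsilon> j = -1"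
  shows "\<exists>R. R \<noteq> 0 \<and> degree R < card J \<and>
    (\<forall>j\<in>J. \<forall>x\<in>{lo j..hi j}. \<epsilon> j * poly R x > 0) \<and>
    (\<forall>x\<ge>lo (Max J). \<epsilon> (Max J) * poly R x > 0)"
  using assms
proof (induction J rule: finite_linorder_max_induct)
  case (insert b A)
  show ?case
  proof (cases "A = {}")
    case True
    have "\<epsilon> b * \<epsilon> b = 1" using insert.prems(2)[of b] by auto
    then show ?thesis using True
      by (intro exI[of _ "[:\<epsilon> b:]"]) auto
  next
    case False
    define m where "m = Max A"
    have m: "m \<in> A" "\<And>j. j \<in> A \<Longrightarrow> j \<le> m" using insert.hyps False by (auto simp: m_def)
    have mb: "hi m < lo b" using insert.hyps m by (intro ordered) auto
    have Maxb: "Max (insert b A) = b"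
      using insert.hyps by (intro Max_eqI) (auto intro: less_imp_le)
    have card: "card (insert b A) = Suc (card A)" using insert.hyps by auto
    obtain R where R: "R \<noteq> 0" "degree R < card A"
      "\<And>j x. j \<in> A \<Longrightarrow> x \<in> {lo j..hi j} \<Longrightarrow> \<epsilon> j * poly R x > 0"
      "\<And>x. x \<ge> lo m \<Longrightarrow> \<epsilon> m * poly R x > 0"
      using insert.IH[OF False] insert.prems(2) m_def by auto
    have beyond: "x \<ge> lo b \<Longrightarrow> x \<ge> lo m" for x
      using mb lo_le_hi[of m] by simp
    show ?thesis
    proof (cases "\<epsilon> b = \<epsilon> m")
      case True
      show ?thesis
        unfolding Maxb card
        by (rule exI[of _ R]) (use R beyond True in auto)
    next
      case False
      then have \<epsilon>b: "\<epsilon> b = - \<epsilon> m"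
        using insert.prems(2)[of b] insert.prems(2)[of m] m by auto
      \<comment> \<open>t lies in the gap before the new interval, and the factor is t - x rather
        than x - t, so that the signs on the earlier intervals survive.\<close>
      define t where "t = (hi m + lo b) / 2"
      define R' where "R' = R * [:t, -1:]"
      have R': "poly R' x = poly R x * (t - x)" for x by (simp add: R'_def algebra_simps)
      have R'b: "\<epsilon> b * poly R' x > 0" if "x \<ge> lo b" for x
      proof -
        have "(\<epsilon> m * poly R x) * (x - t) > 0"
          using that mb by (intro mult_pos_pos R beyond) (auto simp: t_def)
        then show ?thesis by (simp add: R' \<epsilon>b algebra_simps)
      qed
      have R'A: "\<epsilon> j * poly R' x > 0" if "j \<in> A" "x \<in> {lo j..hi j}" for j x
      proof -
        have "hi j \<le> hi m"
          using m(2)[OF that(1)] ordered[of j m] lo_le_hi[of m] by (cases "j = m") (auto simp: order.strict_iff_order)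
        then have "(\<epsilon> j * poly R x) * (t - x) > 0"
          using that mb by (intro mult_pos_pos R) (auto simp: t_def)
        then show ?thesis by (simp add: R' mult.assoc)
      qed
      show ?thesis
        unfolding Maxb card
      proof (intro exI[of _ R'] conjI ballI allI impI)
        show "R' \<noteq> 0" using R(1) by (simp add: R'_def del: mult_pCons_right)
        show "degree R' < Suc (card A)"
          using R(1,2) by (simp add: R'_def degree_mult_eq del: mult_pCons_right)
      qed (use R'b R'A in auto)
    qed
  qed
qed auto

section \<open>Linear forms and their sign changes\<close>

text \<open>A vector of polynomials \<open>A\<close> stands for the linear form \<open>\<Sum>\<^sub>j A j d\<mu>\<^sub>j\<close>.\<close>

definition admissible :: "(nat, 'd) vec \<Rightarrow> ('d \<Rightarrow> real poly) \<Rightarrow> bool" where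
  "admissible n A \<longleftrightarrow> (\<forall>j k. n $ j \<le> k \<longrightarrow> coeff (A j) k = 0)"

definition pairing :: "('d \<Rightarrow> real poly) \<Rightarrow> real poly \<Rightarrow> real" where
  "pairing A p = (\<Sum>j\<in>UNIV. LINT x|\<mu> j. poly (A j * p) x)"

lemma admissible_degree: "admissible n A \<Longrightarrow> A j \<noteq> 0 \<Longrightarrow> degree (A j) < n $ j"
  unfolding admissible_def by (meson leading_coeff_0_iff not_le)

lemma card_sum_le_msize:
  assumes "\<And>j. j \<in> J \<Longrightarrow> Suc (f j) \<le> n $ j"
  shows "card J + (\<Sum>j\<in>J. f j) \<le> msize n"
proof -
  have "card J + (\<Sum>j\<in>J. f j) = (\<Sum>j\<in>J. Suc (f j))"
    unfolding Suc_eq_plus1 by (simp only: sum.distrib) simp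
  also have "\<dots> \<le> (\<Sum>j\<in>J. n $ j)" using assms by (rule sum_mono)
  also have "\<dots> \<le> msize n" unfolding msize_def by (rule sum_mono2) auto
  finally show ?thesis .
qed

text \<open>
  The form has at most \<open>n\<^sub>j - 1\<close> sign changes inside the \<open>j\<close>-th interval and at most one between
  consecutive intervals carrying a nonzero component, so fewer than \<open>|n|\<close> in total.
\<close>

lemma sign_matching_poly:
  assumes adm: "admissible n A" and nz: "A i \<noteq> 0"
  obtains P where "P \<noteq> 0" "degree P < msize n"
    "\<And>j x. x \<in> {lo j..hi j} \<Longrightarrow> poly (A j * P) x \<ge> 0"
proof -
  define J where "J = {j. A j \<noteq> 0}"
  have "\<forall>j\<in>J. \<exists>S r \<epsilon>. finite S \<and> S \<subseteq> {lo j<..<hi j} \<and> A j = (\<Prod>s\<in>S. [:-s, 1:]) * r \<and>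
    (\<epsilon> = 1 \<or> \<epsilon> = (-1::real)) \<and> (\<forall>x\<in>{lo j..hi j}. \<epsilon> * poly r x \<ge> 0)"
    using poly_sign_split by (simp add: J_def)
  then obtain S r \<epsilon> where S: "\<And>j. j \<in> J \<Longrightarrow> finite (S j)" "\<And>j. j \<in> J \<Longrightarrow> S j \<subseteq> {lo j<..<hi j}"
    "\<And>j. j \<in> J \<Longrightarrow> A j = (\<Prod>s\<in>S j. [:-s, 1:]) * r j"
    "\<And>j. j \<in> J \<Longrightarrow> \<epsilon> j = 1 \<or> \<epsilon> j = -1"
    "\<And>j x. j \<in> J \<Longrightarrow> x \<in> {lo j..hi j} \<Longrightarrow> \<epsilon> j * poly (r j) x \<ge> 0"
    unfolding bchoice_iff by blast
  \<comment> \<open>\<open>q j\<close> carries the sign changes of A_j. It will occur squared on the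
    j-th interval, while the product \<open>Q j\<close> of the others has no zero there because the
    intervals are disjoint.\<close>
  define q where "q j = (\<Prod>s\<in>S j. [:-s, 1::real:])" for j
  define Q where "Q j = (\<Prod>k\<in>J - {j}. q k)" for j
  have q_roots: "s \<in> S j" if "j \<in> J" "poly (q j) s = 0" for s j
    using that S(1) by (auto simp: q_def poly_prod)
  have "\<forall>j. \<exists>\<delta>. (\<delta> = 1 \<or> \<delta> = -1) \<and> (\<forall>x\<in>{lo j..hi j}. \<delta> * poly (Q j) x > 0)"
  proof
    fix j
    have "poly (Q j) x \<noteq> 0" if x: "x \<in> {lo j..hi j}" for x
    proof
      assume "poly (Q j) x = 0"
      then obtain k where k: "k \<in> J" "k \<noteq> j" "poly (q k) x = 0"
        by (auto simp: Q_def poly_prod)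
      then have "x \<in> {lo k<..<hi k}" using q_roots S(2) by blast
      then show False using disjoint_hulls[of x k j] x k by simp
    qed
    then show "\<exists>\<delta>. (\<delta> = 1 \<or> \<delta> = -1) \<and> (\<forall>x\<in>{lo j..hi j}. \<delta> * poly (Q j) x > 0)"
      by (rule poly_const_sign)
  qed
  then obtain \<delta> where \<delta>: "\<And>j. \<delta> j = 1 \<or> \<delta> j = (-1::real)"
    "\<And>j x. x \<in> {lo j..hi j} \<Longrightarrow> \<delta> j * poly (Q j) x > 0"
    unfolding choice_iff by blast
  have "J \<noteq> {}" using nz by (auto simp: J_def)
  moreover have "\<epsilon> j * \<delta> j = 1 \<or> \<epsilon> j * \<delta> j = -1" if "j \<in> J" for j
    using S(4)[OF that] \<delta>(1)[of j] by auto
  ultimately have "\<exists>R. R \<noteq> 0 \<and> degree R < card J \<and>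
      (\<forall>j\<in>J. \<forall>x\<in>{lo j..hi j}. (\<epsilon> j * \<delta> j) * poly R x > 0)"
    using sign_pattern_poly[of J "\<lambda>j. \<epsilon> j * \<delta> j"] by (metis finite_code)
  then obtain R where R: "R \<noteq> 0" "degree R < card J"
    "\<And>j x. j \<in> J \<Longrightarrow> x \<in> {lo j..hi j} \<Longrightarrow> (\<epsilon> j * \<delta> j) * poly R x > 0"
    by blast
  \<comment> \<open>On the j-th interval A_j P is q_j^2 times r_j, Q_j and R, and the signs of the
    last three factors multiply to 1.\<close>
  define P where "P = R * (\<Prod>j\<in>J. q j)"
  show thesis
  proof
    have qnz: "q j \<noteq> 0" if "j \<in> J" for j using S(1)[OF that] by (simp add: q_def)
    then show "P \<noteq> 0" using R(1) by (simp add: P_def)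
    have "Suc (degree (q j)) \<le> n $ j" if "j \<in> J" for j
    proof -
      have "A j \<noteq> 0" using that by (simp add: J_def)
      then have "degree (q j) \<le> degree (A j)" using S(3)[OF that] by (simp add: q_def degree_mult_eq)
      then show ?thesis using admissible_degree[OF adm \<open>A j \<noteq> 0\<close>] by simp
    qed
    then have "card J + (\<Sum>j\<in>J. degree (q j)) \<le> msize n" by (rule card_sum_le_msize)
    moreover have "degree P = degree R + (\<Sum>j\<in>J. degree (q j))"
      using R(1) qnz by (simp add: P_def degree_mult_eq degree_prod_eq_sum_degree)
    ultimately show "degree P < msize n" using R(2) by linarith
    fix j x assume x: "x \<in> {lo j..hi j}"
    show "poly (A j * P) x \<ge> 0"
    proof (cases "j \<in> J")
      case True
      have "(\<Prod>j\<in>J. q j) = q j * Q j"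
        using True by (simp add: Q_def prod.remove)
      then have "A j * P = (q j * q j) * (r j * (Q j * R))"
        using S(3)[OF True] by (simp add: P_def q_def mult_ac)
      moreover have "poly (r j) x * (poly (Q j) x * poly R x) \<ge> 0"
      proof -
        have "0 \<le> (\<epsilon> j * poly (r j) x) * ((\<delta> j * poly (Q j) x) * ((\<epsilon> j * \<delta> j) * poly R x))"
          by (intro mult_nonneg_nonneg less_imp_le[OF \<delta>(2)] less_imp_le[OF R(3)] S(5) x True)
        also have "\<dots> = (\<epsilon> j * \<epsilon> j) * (\<delta> j * \<delta> j) * (poly (r j) x * (poly (Q j) x * poly R x))"
          by (simp add: mult_ac)
        also have "\<epsilon> j * \<epsilon> j = 1" using S(4)[OF True] by auto
        also have "\<delta> j * \<delta> j = 1" using \<delta>(1)[of j] by auto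
        finally show ?thesis by simp
      qed
      ultimately show ?thesis by simp
    qed (simp add: J_def)
  qed
qed

lemma weighted_pairing_pos:
  assumes "A i \<noteq> 0" "P \<noteq> 0" "\<And>j x. x \<in> {lo j..hi j} \<Longrightarrow> poly (A j * P) x \<ge> 0"
    and w: "\<And>j x. x \<in> msupport (\<mu> j) \<Longrightarrow> w x > 0"
    and int: "\<And>j. integrable (\<mu> j) (\<lambda>x. poly (A j * P) x * w x)"
  shows "(\<Sum>j\<in>UNIV. LINT x|\<mu> j. poly (A j * P) x * w x) > 0"
proof (rule sum_pos2)
  show "(LINT x|\<mu> i. poly (A i * P) x * w x) > 0"
    using assms msupport_hull[of i] by (intro meas.integral_poly_weight_pos) auto
  show "(LINT x|\<mu> j. poly (A j * P) x * w x) \<ge> 0" for j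
  proof (rule integral_nonneg_AE)
    show "AE x in \<mu> j. 0 \<le> poly (A j * P) x * w x"
      using meas.AE_msupport[of j]
    proof eventually_elim
      case (elim x)
      then show ?case using w[OF elim] assms(3) msupport_hull[of j]
        by (intro mult_nonneg_nonneg less_imp_le[OF w]) auto
    qed
  qed
qed auto

lemma integrable_poly' [simp]: "integrable (\<mu> j) (\<lambda>x. poly p x)"
  using meas.integrable_poly by simp

lemma pairing_add_right: "pairing A (p + q) = pairing A p + pairing A q"
  by (simp add: pairing_def distrib_left sum.distrib del: poly_mult)

lemma pairing_smult_right: "pairing A (smult c p) = c * pairing A p"
  by (simp add: pairing_def sum_distrib_left del: poly_mult)

lemma pairing_add_left: "pairing (\<lambda>j. A j + B j) p = pairing A p + pairing B p"
  by (simp add: pairing_def distrib_right sum.distrib del: poly_mult)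

lemma pairing_smult_left: "pairing (\<lambda>j. smult c (A j)) p = c * pairing A p"
  by (simp add: pairing_def sum_distrib_left del: poly_mult)

lemma pairing_diff_left: "pairing (\<lambda>j. A j - B j) p = pairing A p - pairing B p"
  by (simp add: pairing_def left_diff_distrib sum_subtractf del: poly_mult)

lemma pairing_sum_left: "pairing (\<lambda>j. \<Sum>i\<in>I. A i j) p = (\<Sum>i\<in>I. pairing (A i) p)"
proof -
  have "pairing (\<lambda>j. \<Sum>i\<in>I. A i j) p = (\<Sum>j\<in>UNIV. \<Sum>i\<in>I. LINT x|\<mu> j. poly (A i j * p) x)"
    by (simp add: pairing_def sum_distrib_right poly_sum del: poly_mult)
  then show ?thesis by (simp add: pairing_def sum.swap[of _ I])
qed

lemma pairing_sum_right: "pairing A (\<Sum>i\<in>I. p i) = (\<Sum>i\<in>I. pairing A (p i))"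
  by (induction I rule: infinite_finite_induct)
    (simp_all add: pairing_add_right, simp_all add: pairing_def)

lemma pairing_expand: "pairing A p = (\<Sum>k\<le>degree p. coeff p k * pairing A (monom 1 k))"
proof -
  have "p = (\<Sum>k\<le>degree p. smult (coeff p k) (monom 1 k))"
    using poly_as_sum_of_monoms[of p] by (simp add: smult_monom)
  then have "pairing A p = pairing A (\<Sum>k\<le>degree p. smult (coeff p k) (monom 1 k))" by simp
  then show ?thesis by (simp add: pairing_sum_right pairing_smult_right)
qed

lemma pairing_low_degree:
  assumes "\<And>l. l < N \<Longrightarrow> pairing A (monom 1 l) = 0" "degree p \<le> N"
  shows "pairing A p = coeff p N * pairing A (monom 1 N)"
proof -
  have "pairing A p = (\<Sum>k\<le>degree p. if k = N then coeff p N * pairing A (monom 1 N) else 0)"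
    unfolding pairing_expand[of A p] by (rule sum.cong) (use assms in auto)
  then show ?thesis using assms(2) by (auto simp: coeff_eq_0)
qed

text \<open>Normality for type I: a nonzero form pairs strictly positively with its sign-matching
  polynomial, whose degree lies in the range of the vanishing moments. Uniqueness, normalisability
  and the recurrence of the type I forms all reduce to this.\<close>

lemma admissible_zero_moments:
  assumes "admissible n A" "\<And>l. l < msize n \<Longrightarrow> pairing A (monom 1 l) = 0"
  shows "A = (\<lambda>_. 0)"
proof (rule ccontr)
  assume "A \<noteq> (\<lambda>_. 0)"
  then obtain i where i: "A i \<noteq> 0" by auto
  then obtain P where P: "P \<noteq> 0" "degree P < msize n"
    "\<And>j x. x \<in> {lo j..hi j} \<Longrightarrow> poly (A j * P) x \<ge> 0"
    using sign_matching_poly assms by blast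
  have "pairing A P > 0"
    using weighted_pairing_pos[of A i P "\<lambda>_. 1", OF i P(1) P(3)] by (simp add: pairing_def del: poly_mult)
  moreover have "pairing A P = 0"
    unfolding pairing_expand[of A P] using P(2) assms(2) by (intro sum.neutral) auto
  ultimately show False by simp
qed

end

section \<open>Existence and uniqueness of multiple orthogonal polynomials\<close>

text \<open>Source of both kinds of multiple orthogonal polynomials, by counting unknowns. Each
  equation is used to eliminate one unknown.\<close>

lemma underdetermined_system:
  fixes c :: "'e \<Rightarrow> 'i \<Rightarrow> real"
  assumes "finite E" "finite I" "card E < card I"
  shows "\<exists>x. (\<exists>i\<in>I. x i \<noteq> 0) \<and> (\<forall>e\<in>E. (\<Sum>i\<in>I. c e i * x i) = 0)"
  using assms
proof (induction E arbitrary: I c rule: finite_induct)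
  case empty
  then have "I \<noteq> {}" by auto
  then show ?case by (intro exI[of _ "\<lambda>_. 1"]) auto
next
  case (insert e E)
  show ?case
  proof (cases "\<forall>i\<in>I. c e i = 0")
    case True
    have "card E < card I" using insert by simp
    then obtain x where "\<exists>i\<in>I. x i \<noteq> 0" "\<forall>e\<in>E. (\<Sum>i\<in>I. c e i * x i) = 0"
      using insert by blast
    then show ?thesis using True by (intro exI[of _ x]) auto
  next
    case False
    then obtain k where k: "k \<in> I" "c e k \<noteq> 0" by auto
    let ?I = "I - {k}"
    have "finite ?I" "card E < card ?I" using insert k by auto
    then obtain x where x: "\<exists>i\<in>?I. x i \<noteq> 0"
      "\<forall>f\<in>E. (\<Sum>i\<in>?I. (c f i - c f k * c e i / c e k) * x i) = 0"
      using insert.IH[of ?I "\<lambda>f i. c f i - c f k * c e i / c e k"] by blast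
    define y where "y = x(k := - (\<Sum>i\<in>?I. c e i * x i) / c e k)"
    have sum: "(\<Sum>i\<in>I. c f i * y i) = c f k * y k + (\<Sum>i\<in>?I. c f i * x i)" for f
    proof -
      have "(\<Sum>i\<in>I. c f i * y i) = c f k * y k + (\<Sum>i\<in>?I. c f i * y i)"
        using k insert.prems by (simp add: sum.remove)
      also have "(\<Sum>i\<in>?I. c f i * y i) = (\<Sum>i\<in>?I. c f i * x i)"
        by (rule sum.cong) (auto simp: y_def)
      finally show ?thesis .
    qed
    show ?thesis
    proof (intro exI[of _ y] conjI ballI)
      show "\<exists>i\<in>I. y i \<noteq> 0" using x(1) by (auto simp: y_def)
      fix f assume "f \<in> insert e E"
      then consider "f = e" | "f \<in> E" by auto
      then show "(\<Sum>i\<in>I. c f i * y i) = 0"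
      proof cases
        case 1
        then show ?thesis unfolding sum using k by (simp add: y_def)
      next
        case 2
        then have "(\<Sum>i\<in>?I. c f i * x i) = (\<Sum>i\<in>?I. c f k * c e i / c e k * x i)"
          using x(2) by (simp add: left_diff_distrib sum_subtractf)
        also have "\<dots> = c f k / c e k * (\<Sum>i\<in>?I. c e i * x i)"
          by (simp add: sum_distrib_left mult_ac)
        finally show ?thesis unfolding sum using k by (simp add: y_def)
      qed
    qed
  qed
qed

lemma msize_add_axis: "msize (n + axis j 1) = Suc (msize n)"
  unfolding msize_def by (simp add: sum.distrib axis_def)

lemma msize_diff_axis: "n $ j > 0 \<Longrightarrow> Suc (msize (n - axis j 1)) = msize n"
proof -
  assume "n $ j > 0"
  then have "n - axis j 1 + axis j 1 = n" by (auto simp: vec_eq_iff axis_def)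
  then show ?thesis using msize_add_axis[of "n - axis j 1" j] by simp
qed

context angelesco_system
begin

section \<open>Moments, zeros and the type II polynomials\<close>

definition moment :: "'d \<Rightarrow> real poly \<Rightarrow> nat \<Rightarrow> real" where
  "moment j p l = (LINT x|\<mu> j. poly (monom 1 l * p) x)"

lemma moment_add: "moment j (p + q) l = moment j p l + moment j q l"
  by (simp add: moment_def distrib_left del: poly_mult)

lemma moment_diff: "moment j (p - q) l = moment j p l - moment j q l"
  by (simp add: moment_def right_diff_distrib del: poly_mult)

lemma moment_smult: "moment j (smult c p) l = c * moment j p l"
  by (simp add: moment_def del: poly_mult)

lemma moment_0: "moment j 0 l = 0"
  by (simp add: moment_def)

lemma moment_sum: "moment j (\<Sum>i\<in>I. p i) l = (\<Sum>i\<in>I. moment j (p i) l)"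
  by (induction I rule: infinite_finite_induct) (simp_all add: moment_add moment_0)

lemma moment_pCons: "moment j (pCons 0 p) l = moment j p (Suc l)"
  by (simp add: moment_def monom_Suc)

lemma moment_eq: "moment j p l = (LINT x|\<mu> j. poly p x * x ^ l)"
  by (simp add: moment_def poly_monom mult.commute)

lemma integral_mult_expand:
  assumes "\<And>i. i > N \<Longrightarrow> coeff q i = 0"
  shows "(LINT x|\<mu> j. poly (q * p) x) = (\<Sum>i\<le>N. coeff q i * moment j p i)"
proof -
  have "degree q \<le> N" using assms by (intro degree_le) auto
  then have q: "(\<Sum>i\<le>N. smult (coeff q i) (monom 1 i)) = q"
    using poly_as_sum_of_monoms'[of q N] by (simp add: smult_monom)
  have "q * p = (\<Sum>i\<le>N. smult (coeff q i) (monom 1 i)) * p"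
    by (simp only: q)
  also have "\<dots> = (\<Sum>i\<le>N. smult (coeff q i) (monom 1 i * p))"
    by (simp add: sum_distrib_right)
  finally have "(LINT x|\<mu> j. poly (q * p) x)
      = (LINT x|\<mu> j. poly (\<Sum>i\<le>N. smult (coeff q i) (monom 1 i * p)) x)"
    by (rule arg_cong)
  then show ?thesis by (simp add: poly_sum moment_def del: poly_mult)
qed

definition orth :: "(nat, 'd) vec \<Rightarrow> real poly \<Rightarrow> bool" where
  "orth n p \<longleftrightarrow> (\<forall>j. \<forall>l < n $ j. moment j p l = 0)"

lemma orth_integral:
  assumes "orth n p" "\<And>i. i > n $ j \<Longrightarrow> coeff q i = 0"
  shows "(LINT x|\<mu> j. poly (q * p) x) = coeff q (n $ j) * moment j p (n $ j)"
proof -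
  have "(LINT x|\<mu> j. poly (q * p) x) = (\<Sum>i\<le>n $ j. coeff q i * moment j p i)"
    by (rule integral_mult_expand) (rule assms(2))
  also have "\<dots> = (\<Sum>i\<le>n $ j. if i = n $ j then coeff q i * moment j p i else 0)"
    by (rule sum.cong) (use assms(1) in \<open>auto simp: orth_def\<close>)
  finally show ?thesis by simp
qed

text \<open>With fewer than n_j sign changes, the product q of the linear factors at these points
  would have degree below n_j and be orthogonal to p, although q p has constant sign on the
  interval.\<close>

lemma orth_sign_changes:
  assumes "p \<noteq> 0" "orth n p"
  shows "\<exists>S. finite S \<and> S \<subseteq> {lo j<..<hi j} \<and> n $ j \<le> card S \<and> (\<forall>s\<in>S. poly p s = 0)"
proof -
  obtain S r \<epsilon> where S: "finite S" "S \<subseteq> {lo j<..<hi j}" "p = (\<Prod>s\<in>S. [:-s, 1:]) * r"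
    "\<epsilon> = 1 \<or> \<epsilon> = (-1::real)" "\<forall>x\<in>{lo j..hi j}. \<epsilon> * poly r x \<ge> 0"
    using poly_sign_split[OF \<open>p \<noteq> 0\<close>, of "lo j" "hi j"] by blast
  define q where "q = (\<Prod>s\<in>S. [:-s, 1::real:])"
  have "q \<noteq> 0" using S(1) by (simp add: q_def)
  have deg: "degree q = card S" by (simp add: q_def degree_prod_linear_factors)
  have "n $ j \<le> card S"
  proof (rule ccontr)
    assume "\<not> ?thesis"
    then have "(LINT x|\<mu> j. poly (q * p) x) = 0"
      using orth_integral[OF assms(2), of j q] deg by (simp add: coeff_eq_0)
    then have "(LINT x|\<mu> j. poly (smult \<epsilon> (q * p)) x * 1) = 0"
      by (simp del: poly_mult)
    moreover have "(LINT x|\<mu> j. poly (smult \<epsilon> (q * p)) x * 1) > 0"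
    proof (rule meas.integral_poly_weight_pos)
      show "smult \<epsilon> (q * p) \<noteq> 0" using \<open>q \<noteq> 0\<close> assms(1) S(4) by auto
      show "integrable (\<mu> j) (\<lambda>x. poly (smult \<epsilon> (q * p)) x * 1)"
        by (simp del: poly_mult poly_smult)
      fix x assume "x \<in> msupport (\<mu> j)"
      then have "0 \<le> (poly q x)\<^sup>2 * (\<epsilon> * poly r x)"
        using S(5) msupport_hull by (intro mult_nonneg_nonneg[OF zero_le_power2]) blast
      then show "0 \<le> poly (smult \<epsilon> (q * p)) x"
        by (simp add: S(3) q_def power2_eq_square mult_ac)
    qed simp
    ultimately show False by (simp only: less_irrefl)
  qed
  moreover have "poly p s = 0" if "s \<in> S" for s
    using that S(1) by (auto simp: S(3) poly_prod)
  ultimately show ?thesis using S(1,2) by blast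
qed

lemma orth_factorization:
  assumes "p \<noteq> 0" "orth n p"
  obtains S r where "\<And>j. finite (S j)" "\<And>j. S j \<subseteq> {lo j<..<hi j}" "\<And>j. n $ j \<le> card (S j)"
    "p = (\<Prod>j\<in>UNIV. \<Prod>s\<in>S j. [:-s, 1:]) * r"
proof -
  have "\<forall>j. \<exists>S. finite S \<and> S \<subseteq> {lo j<..<hi j} \<and> n $ j \<le> card S \<and> (\<forall>s\<in>S. poly p s = 0)"
    using orth_sign_changes[OF assms] by blast
  then obtain S where S: "\<And>j. finite (S j)" "\<And>j. S j \<subseteq> {lo j<..<hi j}"
    "\<And>j. n $ j \<le> card (S j)" "\<And>j s. s \<in> S j \<Longrightarrow> poly p s = 0"
    unfolding choice_iff by blast
  have "(\<Prod>s\<in>(\<Union>j. S j). [:-s, 1:]) dvd p"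
    by (rule prod_linear_factors_dvd) (use S in auto)
  moreover have "(\<Prod>s\<in>(\<Union>j. S j). [:-s, 1:]) = (\<Prod>j\<in>UNIV. \<Prod>s\<in>S j. [:-s, 1:])"
  proof (rule prod.UNION_disjoint)
    show "\<forall>i\<in>UNIV. \<forall>j\<in>UNIV. i \<noteq> j \<longrightarrow> S i \<inter> S j = {}"
    proof (intro ballI impI)
      fix i j :: 'd assume "i \<noteq> j"
      show "S i \<inter> S j = {}"
      proof (rule ccontr)
        assume "S i \<inter> S j \<noteq> {}"
        then obtain x where "x \<in> S i" "x \<in> S j" by auto
        then have "x \<in> {lo i<..<hi i}" "x \<in> {lo j<..<hi j}" using S(2) by blast+
        then show False using disjoint_hulls[of x i j] \<open>i \<noteq> j\<close> by auto
      qed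
    qed
  qed (use S in auto)
  ultimately obtain r where "p = (\<Prod>j\<in>UNIV. \<Prod>s\<in>S j. [:-s, 1:]) * r"
    by (auto elim: dvdE)
  then show thesis using that S by blast
qed

text \<open>Normality for type II: zeros found in disjoint intervals are distinct, so their numbers
  add up.\<close>

lemma orth_degree:
  assumes "p \<noteq> 0" "orth n p"
  shows "msize n \<le> degree p"
proof -
  obtain S r where S: "\<And>j. finite (S j)" "\<And>j. n $ j \<le> card (S j)"
    "p = (\<Prod>j\<in>UNIV. \<Prod>s\<in>S j. [:-s, 1:]) * r"
    using orth_factorization[OF assms] by metis
  have "msize n \<le> (\<Sum>j\<in>UNIV. card (S j))"
    unfolding msize_def by (rule sum_mono) (rule S)
  also have "\<dots> = degree (\<Prod>j\<in>UNIV. \<Prod>s\<in>S j. [:-s, 1::real:])"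
    using S(1) by (subst degree_prod_eq_sum_degree) (auto simp: degree_prod_linear_factors)
  also have "\<dots> \<le> degree p"
    using S(3) assms(1) by (intro dvd_imp_degree_le) auto
  finally show ?thesis .
qed

lemma orth_eq_0:
  assumes "orth n p" "\<And>k. k \<ge> msize n \<Longrightarrow> coeff p k = 0"
  shows "p = 0"
  using orth_degree[OF _ assms(1)] assms(2)[of "degree p"] leading_coeff_0_iff by blast

text \<open>There are |n| conditions on |n| + 1 coefficients; \<open>orth_degree\<close> then forces
  the degree to be exactly |n|, so the solution can be made monic.\<close>

lemma mop_II_exists:
  "\<exists>p. degree p = msize n \<and> lead_coeff p = 1 \<and> orth n p"
proof -
  let ?E = "SIGMA j:UNIV. {..<n $ j}"
  have "card ?E = msize n" unfolding msize_def by simp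
  then obtain x where x: "\<exists>i\<in>{..msize n}. x i \<noteq> 0"
    "\<forall>e\<in>?E. (\<Sum>i\<in>{..msize n}. moment (fst e) (monom 1 i) (snd e) * x i) = 0"
    using underdetermined_system[of ?E "{..msize n}" "\<lambda>e i. moment (fst e) (monom 1 i) (snd e)"] by auto
  define p where "p = (\<Sum>i\<le>msize n. smult (x i) (monom 1 i))"
  have coeff: "coeff p k = (if k \<le> msize n then x k else 0)" for k
    unfolding p_def by (auto simp: coeff_sum if_distrib cong: if_cong)
  then have "p \<noteq> 0" using x(1) by (auto simp: poly_eq_iff)
  have orth: "orth n p"
    using x(2) by (auto simp: orth_def p_def moment_sum moment_smult mult.commute)
  have "degree p \<le> msize n" using coeff by (intro degree_le) auto
  with orth_degree[OF \<open>p \<noteq> 0\<close> orth] have "degree p = msize n" by simp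
  moreover have "lead_coeff p \<noteq> 0" using \<open>p \<noteq> 0\<close> by simp
  ultimately show ?thesis using orth
    by (intro exI[of _ "smult (inverse (lead_coeff p)) p"]) (auto simp: orth_def moment_smult)
qed

lemma mop_II_spec:
  "degree (mop_II \<mu> n) = msize n \<and> lead_coeff (mop_II \<mu> n) = 1 \<and> orth n (mop_II \<mu> n)"
proof -
  have "\<exists>!p. degree p = msize n \<and> lead_coeff p = 1 \<and> orth n p"
  proof (rule ex_ex1I[OF mop_II_exists])
    fix p q assume pq: "degree p = msize n \<and> lead_coeff p = 1 \<and> orth n p"
      "degree q = msize n \<and> lead_coeff q = 1 \<and> orth n q"
    have "p - q = 0"
    proof (rule orth_eq_0)
      show "orth n (p - q)" using pq by (simp add: orth_def moment_diff)
      fix k assume "k \<ge> msize n"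
      then show "coeff (p - q) k = 0"
        using pq by (cases "k = msize n") (auto simp: coeff_eq_0)
    qed
    then show "p = q" by simp
  qed
  then show ?thesis
    unfolding mop_II_def moment_eq[symmetric] orth_def by (rule theI')
qed

lemma degree_mop_II: "degree (mop_II \<mu> n) = msize n"
  and coeff_mop_II_msize: "coeff (mop_II \<mu> n) (msize n) = 1"
  and orth_mop_II: "orth n (mop_II \<mu> n)"
  using mop_II_spec[of n] by auto

lemma mop_II_nonzero: "mop_II \<mu> n \<noteq> 0"
  using coeff_mop_II_msize[of n] by auto

lemma mop_II_orth: "l < n $ j \<Longrightarrow> moment j (mop_II \<mu> n) l = 0"
  using orth_mop_II by (simp add: orth_def)

text \<open>The first moment against the j-th measure that orthogonality leaves free; the recurrence
  coefficients a are quotients of these numbers.\<close>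

definition norming :: "(nat, 'd) vec \<Rightarrow> 'd \<Rightarrow> real" where
  "norming n j = moment j (mop_II \<mu> n) (n $ j)"

text \<open>
  Each zero of \<open>P\<^sub>n\<close> to the right of the \<open>j\<close>-th interval contributes a factor \<open>-1\<close> to the sign on that
  interval; the number of these zeros does not involve \<open>n\<^sub>j\<close>.
\<close>

lemma norming_sign: "(-1) ^ (\<Sum>k\<in>{j<..}. n $ k) * norming n j > 0"
proof -
  obtain S r where S: "\<And>j. finite (S j)" "\<And>j. S j \<subseteq> {lo j<..<hi j}" "\<And>j. n $ j \<le> card (S j)"
    "mop_II \<mu> n = (\<Prod>j\<in>UNIV. \<Prod>s\<in>S j. [:-s, 1:]) * r"
    using orth_factorization[OF mop_II_nonzero orth_mop_II] by metis
  define q where "q j = (\<Prod>s\<in>S j. [:-s, 1::real:])" for j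
  have q: "degree (q j) = card (S j)" "lead_coeff (q j) = 1" "q j \<noteq> 0" for j
  proof -
    show "degree (q j) = card (S j)" by (simp add: q_def degree_prod_linear_factors)
    show lead: "lead_coeff (q j) = 1" unfolding q_def lead_coeff_prod by simp
    show "q j \<noteq> 0" using lead by auto
  qed
  have P: "mop_II \<mu> n = (\<Prod>j\<in>UNIV. q j) * r" using S(4) by (simp add: q_def)
  have rnz: "r \<noteq> 0" using mop_II_nonzero[of n] P by auto
  \<comment> \<open>The degrees add up only if the j-th interval holds exactly n_j zeros and r is
    constant, so P_n is the product of the \<open>q j\<close>.\<close>
  have "msize n = (\<Sum>j\<in>UNIV. card (S j)) + degree r"
    using rnz q by (simp add: P degree_mult_eq degree_prod_eq_sum_degree flip: degree_mop_II)
  moreover have "msize n \<le> (\<Sum>j\<in>UNIV. card (S j))"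
    unfolding msize_def by (rule sum_mono) (rule S)
  ultimately have deg: "degree r = 0" and card_eq: "(\<Sum>j\<in>UNIV. n $ j) = (\<Sum>j\<in>UNIV. card (S j))"
    by (auto simp: msize_def)
  have card: "card (S j) = n $ j" for j
    using sum_mono_inv[OF card_eq, of j] S(3) by simp
  have "lead_coeff r = 1"
    using mop_II_spec[of n] q by (simp add: P lead_coeff_mult lead_coeff_prod)
  then have r: "r = 1" using deg by (metis degree_eq_zeroE lead_coeff_pCons(2) one_pCons)
  let ?N = "\<Sum>k\<in>{j<..}. n $ k"
  define c :: real where "c = (-1) ^ ?N"
  define T where "T = (\<Prod>k\<in>{..<j}. q k) * (\<Prod>k\<in>{j<..}. q k)"
  have "(\<Prod>j\<in>UNIV. q j) = q j * T"
  proof -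
    have "UNIV = insert j ({..<j} \<union> {j<..})" by auto
    then have "(\<Prod>j\<in>UNIV. q j) = (\<Prod>j\<in>insert j ({..<j} \<union> {j<..}). q j)" by simp
    also have "\<dots> = q j * T"
      unfolding T_def by (subst prod.insert) (auto intro!: prod.union_disjoint)
    finally show ?thesis .
  qed
  then have PT: "mop_II \<mu> n = q j * T" using P r by simp
  have T: "c * poly T x > 0" if x: "x \<in> {lo j..hi j}" for x
  proof -
    have "poly (q k) x > 0" if "k < j" for k
      unfolding q_def poly_prod
    proof (rule prod_pos)
      fix s assume "s \<in> S k"
      then have "s < hi k" using S(2) by fastforce
      then show "0 < poly [:-s, 1:] x" using ordered[OF that] x by simp
    qed
    moreover have "(-1) ^ (n $ k) * poly (q k) x > 0" if "j < k" for k
    proof -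
      have "(-1) ^ (n $ k) * poly (q k) x = (\<Prod>s\<in>S k. (-1) * (x - s))"
        unfolding prod.distrib by (simp add: q_def poly_prod card)
      also have "\<dots> > 0"
      proof (rule prod_pos)
        fix s assume "s \<in> S k"
        then have "s > lo k" using S(2) by fastforce
        then show "0 < (-1) * (x - s)" using ordered[OF that] x by simp
      qed
      finally show ?thesis .
    qed
    ultimately have "(\<Prod>k\<in>{..<j}. poly (q k) x) * (\<Prod>k\<in>{j<..}. (-1) ^ (n $ k) * poly (q k) x) > 0"
      by (intro mult_pos_pos[OF prod_pos prod_pos]) auto
    moreover have "c = (\<Prod>k\<in>{j<..}. (-1) ^ (n $ k))" by (simp add: c_def power_sum)
    ultimately show ?thesis
      by (simp add: T_def poly_prod prod.distrib mult_ac)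
  qed
  have "T \<noteq> 0" using T[of "lo j"] lo_le_hi[of j] by auto
  have "(LINT x|\<mu> j. poly (smult c (q j * mop_II \<mu> n)) x * 1) > 0"
  proof (rule meas.integral_poly_weight_pos)
    show "smult c (q j * mop_II \<mu> n) \<noteq> 0" using q mop_II_nonzero by (simp add: c_def)
    show "integrable (\<mu> j) (\<lambda>x. poly (smult c (q j * mop_II \<mu> n)) x * 1)"
      by (simp del: poly_mult poly_smult)
    fix x assume "x \<in> msupport (\<mu> j)"
    then have "x \<in> {lo j..hi j}" using msupport_hull by blast
    then have "0 \<le> (poly (q j) x)\<^sup>2 * (c * poly T x)"
      by (intro mult_nonneg_nonneg[OF zero_le_power2] less_imp_le[OF T])
    then show "0 \<le> poly (smult c (q j * mop_II \<mu> n)) x"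
      by (simp add: PT power2_eq_square mult_ac)
  qed simp
  \<comment> \<open>\<open>q j\<close> is monic of degree n_j, and the lower moments of P_n
    vanish.\<close>
  also have "(LINT x|\<mu> j. poly (smult c (q j * mop_II \<mu> n)) x * 1) = c * norming n j"
    using orth_integral[OF orth_mop_II[of n], of j "q j"] q(1,2)[of j] card[of j]
    by (simp add: norming_def coeff_eq_0 del: poly_mult)
  finally show ?thesis by (simp add: c_def)
qed

lemma norming_nonzero: "norming n j \<noteq> 0"
  using norming_sign[of n j] by auto

section \<open>Existence and uniqueness of the type I polynomials\<close>

text \<open>The |n| coefficients face |n| - 1 conditions. The remaining moment of a nonzero solution
  cannot vanish by \<open>admissible_zero_moments\<close>, so it can be scaled to 1.\<close>

lemma mop_I_exists:
  assumes "msize n > 0"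
  shows "\<exists>A. admissible n A \<and> (\<forall>l. l + 2 \<le> msize n \<longrightarrow> pairing A (monom 1 l) = 0) \<and>
    pairing A (monom 1 (msize n - 1)) = 1"
proof -
  let ?I = "SIGMA j:UNIV. {..<n $ j}"
  have "card ?I = msize n" unfolding msize_def by simp
  moreover have "finite ?I" by (intro finite_SigmaI) auto
  ultimately obtain x where x: "\<exists>i\<in>?I. x i \<noteq> 0"
    "\<forall>l\<in>{..<msize n - 1}. (\<Sum>i\<in>?I. moment (fst i) (monom 1 (snd i)) l * x i) = 0"
    using underdetermined_system[of "{..<msize n - 1}" ?I "\<lambda>l i. moment (fst i) (monom 1 (snd i)) l"] assms
    by auto
  define A where "A j = (\<Sum>k<n $ j. smult (x (j, k)) (monom 1 k))" for j
  have coeff: "coeff (A j) k = (if k < n $ j then x (j, k) else 0)" for j k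
    unfolding A_def by (auto simp: coeff_sum if_distrib cong: if_cong)
  then have adm: "admissible n A" by (simp add: admissible_def)
  have "pairing A (monom 1 l) = (\<Sum>j\<in>UNIV. moment j (A j) l)" for l
    by (simp add: pairing_def moment_def mult.commute)
  also have "\<dots> l = (\<Sum>i\<in>?I. moment (fst i) (monom 1 (snd i)) l * x i)" for l
  proof -
    have "moment j (A j) l = (\<Sum>k<n $ j. moment j (monom 1 k) l * x (j, k))" for j
      by (simp add: A_def moment_sum moment_smult mult.commute)
    then show ?thesis by (simp add: sum.Sigma split_def)
  qed
  finally have low: "pairing A (monom 1 l) = 0" if "l < msize n - 1" for l
    using x(2) that by simp
  have "A \<noteq> (\<lambda>_. 0)"
  proof
    assume "A = (\<lambda>_. 0)"
    then have "x (j, k) = 0" if "k < n $ j" for j k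
      using coeff[of j k] that by simp
    then show False using x(1) by auto
  qed
  then obtain l where "l < msize n" "pairing A (monom 1 l) \<noteq> 0"
    using admissible_zero_moments[OF adm] by blast
  moreover from this have "l = msize n - 1" using low[of l] by linarith
  ultimately have nz: "pairing A (monom 1 (msize n - 1)) \<noteq> 0" by simp
  then show ?thesis
    using adm low
    by (intro exI[of _ "\<lambda>j. smult (inverse (pairing A (monom 1 (msize n - 1)))) (A j)"])
      (auto simp: pairing_smult_left admissible_def)
qed

lemma mop_I_spec:
  assumes "msize n > 0"
  shows "admissible n (mop_I \<mu> n) \<and> (\<forall>l. l + 2 \<le> msize n \<longrightarrow> pairing (mop_I \<mu> n) (monom 1 l) = 0) \<and>
    pairing (mop_I \<mu> n) (monom 1 (msize n - 1)) = 1"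
proof -
  have uniq: "\<exists>!A. admissible n A \<and> (\<forall>l. l + 2 \<le> msize n \<longrightarrow> pairing A (monom 1 l) = 0) \<and>
    pairing A (monom 1 (msize n - 1)) = 1"
  proof (rule ex_ex1I[OF mop_I_exists[OF assms]])
    fix A B assume A: "admissible n A \<and> (\<forall>l. l + 2 \<le> msize n \<longrightarrow> pairing A (monom 1 l) = 0) \<and>
      pairing A (monom 1 (msize n - 1)) = 1"
      and B: "admissible n B \<and> (\<forall>l. l + 2 \<le> msize n \<longrightarrow> pairing B (monom 1 l) = 0) \<and>
      pairing B (monom 1 (msize n - 1)) = 1"
    have "(\<lambda>j. A j - B j) = (\<lambda>_. 0)"
    proof (rule admissible_zero_moments)
      show "admissible n (\<lambda>j. A j - B j)" using A B by (simp add: admissible_def)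
      fix l assume "l < msize n"
      then consider "l + 2 \<le> msize n" | "l = msize n - 1" by linarith
      then show "pairing (\<lambda>j. A j - B j) (monom 1 l) = 0"
        using A B by cases (simp_all add: pairing_diff_left)
    qed
    then show "A = B" by (simp add: fun_eq_iff)
  qed
  have adm: "admissible n A \<longleftrightarrow> (\<forall>j. if n $ j = 0 then A j = 0 else degree (A j) \<le> n $ j - 1)" for A
  proof -
    have "(\<forall>k\<ge>n $ j. coeff (A j) k = 0) \<longleftrightarrow> (if n $ j = 0 then A j = 0 else degree (A j) \<le> n $ j - 1)" for j
    proof (cases "n $ j")
      case 0
      then show ?thesis by (simp add: poly_eq_iff)
    next
      case (Suc m)
      then show ?thesis
        by (auto simp: Suc_le_eq intro!: degree_le coeff_eq_0)
    qed
    then show ?thesis by (simp add: admissible_def)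
  qed
  have pair: "pairing A (monom 1 l) = (\<Sum>j\<in>UNIV. LINT x|\<mu> j. x ^ l * poly (A j) x)" for A l
    by (simp add: pairing_def poly_monom mult.commute)
  have eq: "mop_I \<mu> n = (THE A. admissible n A \<and>
      (\<forall>l. l + 2 \<le> msize n \<longrightarrow> pairing A (monom 1 l) = 0) \<and> pairing A (monom 1 (msize n - 1)) = 1)"
    unfolding mop_I_def adm pair ..
  show ?thesis unfolding eq by (rule theI'[OF uniq])
qed

end

section \<open>Nearest-neighbour recurrences\<close>

text \<open>Keeps \<open>axis j 1\<close> in the form in which it occurs in the definitions.\<close>

declare One_nat_def [simp del]

lemma axis_nth: "axis j c $ k = (if k = j then c else 0)"
  by (simp add: axis_def)

context angelesco_system
begin

text \<open>Integrating the type II recurrence against x^(n_l - 1) over the l-th measure leaves only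
  x P_n and the term at n - e_l; this gives the quotient.\<close>

definition a_coeff :: "(nat, 'd) vec \<Rightarrow> 'd \<Rightarrow> real" where
  "a_coeff n l = (if n $ l = 0 then 0 else norming n l / norming (n - axis l 1) l)"

text \<open>Obtained by comparing coefficients of order |n|, which the terms at n - e_l do not
  reach.\<close>

definition b_coeff :: "(nat, 'd) vec \<Rightarrow> 'd \<Rightarrow> real" where
  "b_coeff n j = coeff (pCons 0 (mop_II \<mu> n) - mop_II \<mu> (n + axis j 1)) (msize n)"

text \<open>The difference of the two sides has degree below |n| by the choice of b, and is
  orthogonal for n by the choice of a, which matters only in the moment of order n_k - 1. Then
  \<open>orth_eq_0\<close> applies.\<close>

lemma mop_II_recurrence:
  "pCons 0 (mop_II \<mu> n) = mop_II \<mu> (n + axis j 1) + smult (b_coeff n j) (mop_II \<mu> n) +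
    (\<Sum>l\<in>UNIV. if n $ l = 0 then 0 else smult (a_coeff n l) (mop_II \<mu> (n - axis l 1)))"
proof -
  let ?R = "\<lambda>l. if n $ l = 0 then 0 else smult (a_coeff n l) (mop_II \<mu> (n - axis l 1))"
  define D where "D = pCons 0 (mop_II \<mu> n) - mop_II \<mu> (n + axis j 1) - smult (b_coeff n j) (mop_II \<mu> n) - (\<Sum>l\<in>UNIV. ?R l)"
  have "D = 0"
  proof (rule orth_eq_0)
    fix k assume k: "msize n \<le> k"
    have R0: "coeff (\<Sum>l\<in>UNIV. ?R l) k = 0"
      unfolding coeff_sum
    proof (rule sum.neutral, rule ballI)
      fix l
      have "coeff (mop_II \<mu> (n - axis l 1)) k = 0" if "n $ l \<noteq> 0"
        using that k msize_diff_axis[of n l] degree_mop_II[of "n - axis l 1"]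
        by (intro coeff_eq_0) simp
      then show "coeff (?R l) k = 0" by simp
    qed
    consider "k = msize n" | "k = Suc (msize n)" | "k > Suc (msize n)" using k by linarith
    then show "coeff D k = 0"
    proof cases
      case 1
      then show ?thesis using R0 by (simp add: D_def b_coeff_def coeff_mop_II_msize)
    next
      case 2
      have "coeff (mop_II \<mu> (n + axis j 1)) (Suc (msize n)) = 1"
        using coeff_mop_II_msize[of "n + axis j 1"] by (simp only: msize_add_axis)
      moreover have "coeff (mop_II \<mu> n) (Suc (msize n)) = 0"
        by (simp add: coeff_eq_0 degree_mop_II)
      ultimately show ?thesis using R0 2 by (simp add: D_def coeff_mop_II_msize)
    next
      case 3
      then obtain k' where "k = Suc k'" "k' > msize n" by (cases k) auto
      then show ?thesis using R0 3
        by (simp add: D_def coeff_eq_0 degree_mop_II msize_add_axis)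
    qed
  next
    show "orth n D"
      unfolding orth_def
    proof (intro allI impI)
      fix k l assume l: "l < n $ k"
      have R: "moment k (?R i) l = (if i = k \<and> Suc l = n $ k then norming n k else 0)" for i
      proof (cases "n $ i = 0")
        case False
        show ?thesis
        proof (cases "i = k \<and> Suc l = n $ k")
          case True
          then have "n $ k = Suc l" by simp
          then have "(n - axis k 1) $ k = l" by (simp add: axis_nth)
          then have "norming (n - axis k 1) k = moment k (mop_II \<mu> (n - axis k 1)) l"
            by (simp add: norming_def)
          moreover have "norming (n - axis k 1) k \<noteq> 0" by (rule norming_nonzero)
          ultimately show ?thesis using True False by (simp add: moment_smult a_coeff_def)
        next
          case F: False
          then have "l < (n - axis i 1) $ k" using l by (auto simp: axis_nth)
          then show ?thesis using F False by (auto simp: moment_smult mop_II_orth)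
        qed
      qed (use l in \<open>auto simp: moment_0\<close>)
      have "moment k (\<Sum>i\<in>UNIV. ?R i) l = (if Suc l = n $ k then norming n k else 0)"
        unfolding moment_sum R by (simp add: sum.delta if_distrib cong: if_cong)
      moreover have "moment k (mop_II \<mu> (n + axis j 1)) l = 0" "moment k (mop_II \<mu> n) l = 0"
        using l by (auto intro!: mop_II_orth simp: axis_nth)
      moreover have "moment k (pCons 0 (mop_II \<mu> n)) l = (if Suc l = n $ k then norming n k else 0)"
        using l by (auto simp: moment_pCons norming_def intro!: mop_II_orth)
      ultimately show "moment k D l = 0"
        unfolding D_def by (simp add: moment_diff moment_smult)
    qed
  qed
  then show ?thesis by (simp add: D_def algebra_simps)
qed

lemma is_rec_coeffs_unique:
  assumes "is_rec_coeffs \<mu> (a, b)"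
  shows "a = a_coeff" "b = b_coeff"
proof -
  have a0: "a n l = 0" if "n $ l = 0" for n l
    using assms that by (simp add: is_rec_coeffs_def)
  have rec: "pCons 0 (mop_II \<mu> n) = mop_II \<mu> (n + axis j 1) + smult (b n j) (mop_II \<mu> n) +
      (\<Sum>l\<in>UNIV. if n $ l = 0 then 0 else smult (a n l) (mop_II \<mu> (n - axis l 1)))" (is "_ = _ + _ + (\<Sum>l\<in>UNIV. ?R n l)") for n j
    using assms unfolding is_rec_coeffs_def by simp
  have "b n j = b_coeff n j" for n j
  proof -
    have "coeff (\<Sum>l\<in>UNIV. ?R n l) (msize n) = 0"
      unfolding coeff_sum
    proof (rule sum.neutral, rule ballI)
      fix l
      have "coeff (mop_II \<mu> (n - axis l 1)) (msize n) = 0" if "n $ l \<noteq> 0"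
        using that msize_diff_axis[of n l] degree_mop_II[of "n - axis l 1"]
        by (intro coeff_eq_0) simp
      then show "coeff (?R n l) (msize n) = 0" by simp
    qed
    then show ?thesis
      unfolding b_coeff_def rec[of n j] by (simp add: coeff_mop_II_msize)
  qed
  then show "b = b_coeff" by (simp add: fun_eq_iff)
  have "a n k = a_coeff n k" for n k
  proof (cases "n $ k")
    case 0
    then show ?thesis using a0 by (simp add: a_coeff_def)
  next
    case (Suc l)
    have R: "moment k (?R n i) l = (if i = k then a n k * norming (n - axis k 1) k else 0)" for i
    proof (cases "i = k")
      case True
      have "(n - axis k 1) $ k = l" using Suc by (simp add: axis_nth)
      then show ?thesis using True Suc by (simp add: moment_smult norming_def)
    next
      case False
      then have "l < (n - axis i 1) $ k" using Suc by (simp add: axis_nth)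
      then show ?thesis using False by (simp add: moment_smult mop_II_orth moment_0)
    qed
    have "norming n k = moment k (pCons 0 (mop_II \<mu> n)) l"
      using Suc by (simp add: moment_pCons norming_def)
    also have "\<dots> = a n k * norming (n - axis k 1) k"
      unfolding rec[of n k] moment_add moment_sum R moment_smult
      using Suc by (simp add: mop_II_orth axis_nth)
    finally show ?thesis using Suc norming_nonzero by (simp add: a_coeff_def)
  qed
  then show "a = a_coeff" by (simp add: fun_eq_iff)
qed

lemma rec_coeffs_eq: "rec_a \<mu> = a_coeff" "rec_b \<mu> = b_coeff"
proof -
  have "is_rec_coeffs \<mu> (a_coeff, b_coeff)"
    unfolding is_rec_coeffs_def using mop_II_recurrence by (simp add: a_coeff_def)
  then have "(THE ab. is_rec_coeffs \<mu> ab) = (a_coeff, b_coeff)"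
    by (rule the_equality) (use is_rec_coeffs_unique in force)
  then show "rec_a \<mu> = a_coeff" "rec_b \<mu> = b_coeff" by (simp_all add: rec_a_def rec_b_def)
qed

text \<open>Both norming constants have the sign given by the components to the right of l, and
  these are not affected by subtracting e_l.\<close>

lemma a_coeff_pos:
  assumes "n $ l > 0"
  shows "a_coeff n l > 0"
proof -
  define c :: real where "c = (-1) ^ (\<Sum>k\<in>{l<..}. n $ k)"
  have "(\<Sum>k\<in>{l<..}. (n - axis l 1) $ k) = (\<Sum>k\<in>{l<..}. n $ k)"
    by (rule sum.cong) (auto simp: axis_nth)
  then have "c * norming n l > 0" "c * norming (n - axis l 1) l > 0"
    using norming_sign[of n l] norming_sign[of "n - axis l 1" l] by (simp_all add: c_def)
  moreover have "a_coeff n l = (c * norming n l) / (c * norming (n - axis l 1) l)"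
    using assms by (simp add: a_coeff_def c_def)
  ultimately show ?thesis by (simp only: divide_pos_pos)
qed

section \<open>Moments, leading coefficients and recurrence of the type I forms\<close>

lemma coeff_mop_I_ge: "msize n > 0 \<Longrightarrow> n $ j \<le> k \<Longrightarrow> coeff (mop_I \<mu> n j) k = 0"
  using mop_I_spec[of n] by (simp add: admissible_def)

lemma pairing_mop_I:
  assumes "msize n > 0" "degree p < msize n"
  shows "pairing (mop_I \<mu> n) p = coeff p (msize n - 1)"
  using pairing_low_degree[of "msize n - 1" "mop_I \<mu> n" p] mop_I_spec[OF assms(1)] assms by auto

lemma pairing_mop_I_monom:
  assumes "l < msize n"
  shows "pairing (mop_I \<mu> n) (monom 1 l) = (if Suc l = msize n then 1 else 0)"
  using assms by (subst pairing_mop_I) (auto simp: degree_monom_eq)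

lemma pairing_mop_I_orth:
  assumes "msize n > 0" "orth m p" "\<And>j. n $ j \<le> Suc (m $ j)"
  shows "pairing (mop_I \<mu> n) p = (\<Sum>j\<in>UNIV. coeff (mop_I \<mu> n j) (m $ j) * moment j p (m $ j))"
  unfolding pairing_def
proof (rule sum.cong[OF refl])
  fix j
  show "(LINT x|\<mu> j. poly (mop_I \<mu> n j * p) x) = coeff (mop_I \<mu> n j) (m $ j) * moment j p (m $ j)"
  proof (rule orth_integral[OF assms(2)])
    fix i assume "m $ j < i"
    then show "coeff (mop_I \<mu> n j) i = 0" using assms(3)[of j] by (intro coeff_mop_I_ge assms) simp
  qed
qed

text \<open>Pair Q_n with the monic P at n - e_k. Its degree is |n| - 1, so the value is 1; by
  orthogonality only the top coefficient of the k-th component contributes.\<close>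

lemma lead_coeff_mop_I:
  assumes "n $ k > 0"
  shows "coeff (mop_I \<mu> n k) (n $ k - 1) = inverse (norming (n - axis k 1) k)"
proof -
  let ?m = "n - axis k 1"
  have m: "Suc (msize ?m) = msize n" using assms by (rule msize_diff_axis)
  then have pos: "msize n > 0" by simp
  have "1 = coeff (mop_II \<mu> ?m) (msize ?m)" by (simp add: coeff_mop_II_msize)
  also have "\<dots> = pairing (mop_I \<mu> n) (mop_II \<mu> ?m)"
  proof -
    have "msize ?m = msize n - 1" using m by simp
    then show ?thesis using pos by (subst pairing_mop_I) (auto simp: degree_mop_II)
  qed
  also have "\<dots> = (\<Sum>j\<in>UNIV. coeff (mop_I \<mu> n j) (?m $ j) * norming ?m j)"
    unfolding norming_def
    by (rule pairing_mop_I_orth[OF pos orth_mop_II]) (auto simp: axis_nth)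
  also have "\<dots> = (\<Sum>j\<in>UNIV. if j = k then coeff (mop_I \<mu> n k) (n $ k - 1) * norming ?m k else 0)"
    by (rule sum.cong) (use pos in \<open>auto simp: axis_nth coeff_mop_I_ge\<close>)
  finally have "coeff (mop_I \<mu> n k) (n $ k - 1) * norming ?m k = 1" by simp
  then show ?thesis using norming_nonzero[of ?m k] by (simp add: field_simps)
qed

text \<open>Q_n and P_n pair to zero because every component has degree below n_j. Apart from its
  leading power, P_n has degree below |n|, so Q_n picks out one coefficient of that rest.\<close>

lemma top_moment_mop_I:
  assumes "msize n > 0"
  shows "pairing (mop_I \<mu> n) (monom 1 (msize n)) = - coeff (mop_II \<mu> n) (msize n - 1)"
proof -
  let ?P = "mop_II \<mu> n" and ?N = "msize n"
  have "pairing (mop_I \<mu> n) ?P = (\<Sum>j\<in>UNIV. coeff (mop_I \<mu> n j) (n $ j) * norming n j)"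
    unfolding norming_def by (rule pairing_mop_I_orth[OF assms orth_mop_II]) simp
  then have "pairing (mop_I \<mu> n) ?P = 0" using assms by (simp add: coeff_mop_I_ge)
  moreover have "pairing (mop_I \<mu> n) ?P = pairing (mop_I \<mu> n) (monom 1 ?N) + pairing (mop_I \<mu> n) (?P - monom 1 ?N)"
    by (simp flip: pairing_add_right)
  moreover have "pairing (mop_I \<mu> n) (?P - monom 1 ?N) = coeff (?P - monom 1 ?N) (?N - 1)"
  proof (rule pairing_mop_I[OF assms])
    have "degree (?P - monom 1 ?N) \<le> ?N - 1"
    proof (rule degree_le, intro allI impI)
      fix i assume "?N - 1 < i"
      then show "coeff (?P - monom 1 ?N) i = 0"
        using coeff_mop_II_msize[of n] by (cases "i = ?N") (auto simp: coeff_eq_0 degree_mop_II)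
    qed
    then show "degree (?P - monom 1 ?N) < ?N" using assms by linarith
  qed
  ultimately show ?thesis using assms by (auto split: if_splits)
qed

lemma pairing_pCons_monom: "pairing (\<lambda>k. pCons 0 (A k)) (monom 1 l) = pairing A (monom 1 (Suc l))"
proof -
  have "pCons 0 (A k) * monom 1 l = A k * monom 1 (Suc l)" for k
    by (simp add: monom_Suc)
  then show ?thesis by (simp add: pairing_def)
qed

text \<open>The difference of the two sides is admissible for n and has |n| vanishing moments.
  Multiplication by x and the shifts to n + e_l overshoot only in order n_k, where the choice of a
  cancels them. Since there are at least two measures, n - e_j is nonzero and its type I form is
  normalised.\<close>

lemma mop_I_recurrence:
  assumes pos: "\<And>k. n $ k > 0" and card: "CARD('d) \<ge> 2"
  shows "pCons 0 (mop_I \<mu> n k) = mop_I \<mu> (n - axis j 1) k + smult (b_coeff (n - axis j 1) j) (mop_I \<mu> n k)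
    + (\<Sum>l\<in>UNIV. smult (a_coeff n l) (mop_I \<mu> (n + axis l 1) k))"
proof -
  let ?m = "n - axis j 1" and ?b = "b_coeff (n - axis j 1) j"
  have "1 \<le> n $ k" for k using pos[of k] by linarith
  then have "2 \<le> msize n"
    using card sum_mono[of UNIV "\<lambda>_. 1" "\<lambda>k. n $ k"] by (simp add: msize_def)
  moreover have "Suc (msize ?m) = msize n" by (rule msize_diff_axis) (rule pos)
  ultimately have m: "msize n = Suc (msize ?m)" "msize ?m > 0" "msize n > 0" by auto
  have mj: "?m + axis j 1 = n" using pos[of j] by (auto simp: vec_eq_iff axis_nth)
  define E where "E k = pCons 0 (mop_I \<mu> n k) - mop_I \<mu> ?m k - smult ?b (mop_I \<mu> n k)
    - (\<Sum>l\<in>UNIV. smult (a_coeff n l) (mop_I \<mu> (n + axis l 1) k))" for k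
  have "E = (\<lambda>_. 0)"
  proof (rule admissible_zero_moments)
    show "admissible n E"
      unfolding admissible_def
    proof (intro allI impI)
      fix k i assume i: "n $ k \<le> i"
      then obtain i' where i': "i = Suc i'" using pos[of k] by (cases i) auto
      have up: "coeff (mop_I \<mu> (n + axis l 1) k) i =
          (if l = k \<and> i = n $ k then inverse (norming n k) else 0)" for l
      proof (cases "l = k \<and> i = n $ k")
        case True
        have "n + axis k 1 - axis k 1 = n" by (auto simp: vec_eq_iff axis_nth)
        then show ?thesis
          using True lead_coeff_mop_I[of "n + axis k 1" k] by (simp add: axis_nth)
      next
        case False
        then have "coeff (mop_I \<mu> (n + axis l 1) k) i = 0"
          using i by (intro coeff_mop_I_ge) (auto simp: msize_add_axis axis_nth)
        then show ?thesis using False by auto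
      qed
      have "coeff (\<Sum>l\<in>UNIV. smult (a_coeff n l) (mop_I \<mu> (n + axis l 1) k)) i
          = (if i = n $ k then a_coeff n k * inverse (norming n k) else 0)"
        unfolding coeff_sum coeff_smult up by (simp add: if_distrib[of "\<lambda>x. _ * x"] cong: if_cong)
      also have "\<dots> = coeff (pCons 0 (mop_I \<mu> n k)) i"
      proof (cases "i = n $ k")
        case True
        then have "i' = n $ k - 1" using i' by simp
        then have "coeff (pCons 0 (mop_I \<mu> n k)) i = inverse (norming (n - axis k 1) k)"
          unfolding i' coeff_pCons_Suc using lead_coeff_mop_I[of n k] pos[of k] by simp
        then show ?thesis
          using pos[of k] norming_nonzero[of n k] True by (simp add: a_coeff_def divide_inverse)
      next
        case False
        then show ?thesis using i i' by (simp add: coeff_mop_I_ge m)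
      qed
      finally show "coeff (E k) i = 0"
        using i m by (simp add: E_def coeff_mop_I_ge axis_nth)
    qed
  next
    fix l assume l: "l < msize n"
    have "pairing (\<lambda>k. \<Sum>i\<in>UNIV. smult (a_coeff n i) (mop_I \<mu> (n + axis i 1) k)) (monom 1 l) = 0"
      using l by (simp add: pairing_sum_left pairing_smult_left pairing_mop_I_monom msize_add_axis)
    then have E: "pairing E (monom 1 l) = pairing (mop_I \<mu> n) (monom 1 (Suc l))
        - pairing (mop_I \<mu> ?m) (monom 1 l) - ?b * pairing (mop_I \<mu> n) (monom 1 l)"
      unfolding E_def by (simp add: pairing_diff_left pairing_smult_left pairing_pCons_monom)
    show "pairing E (monom 1 l) = 0"
    proof (cases "l = msize ?m")
      case True
      \<comment> \<open>b is the difference of the subleading coefficients of P at n - e_j and at n,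
        and \<open>top_moment_mop_I\<close> identifies these with moments of the two forms.\<close>
      have "?b = coeff (mop_II \<mu> ?m) (msize ?m - 1) - coeff (mop_II \<mu> n) (msize ?m)"
        unfolding b_coeff_def mj using m by (simp add: coeff_pCons split: nat.split)
      then show ?thesis
        unfolding E using top_moment_mop_I[of n] top_moment_mop_I[of ?m] m True
        by (simp add: pairing_mop_I_monom)
    next
      case False
      then show ?thesis using l m by (simp add: E pairing_mop_I_monom)
    qed
  qed
  then have "E k = 0" by simp
  then show ?thesis by (simp add: E_def algebra_simps)
qed

end

section \<open>Functions of the second kind\<close>

context angelesco_system
begin

definition off_support :: "complex \<Rightarrow> bool" where
  "off_support z \<longleftrightarrow> (\<forall>j. z \<notin> complex_of_real ` msupport (\<mu> j))"

lemma off_support_nonreal: "Im z \<noteq> 0 \<Longrightarrow> off_support z"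
  by (auto simp: off_support_def)

text \<open>Order 0 is \<open>pairing\<close>; for the type I form and p = 1, order 1 is the
  function of the second kind and order 2 is minus its derivative.\<close>

definition kernel_int :: "complex \<Rightarrow> nat \<Rightarrow> ('d \<Rightarrow> real poly) \<Rightarrow> real poly \<Rightarrow> complex" where
  "kernel_int z m A p =
     (\<Sum>j\<in>UNIV. LINT x|\<mu> j. complex_of_real (poly (A j * p) x) / (z - complex_of_real x) ^ m)"

lemma integrable_kernel:
  assumes "off_support z"
  shows "integrable (\<mu> j) (\<lambda>x. complex_of_real (poly p x) / (z - complex_of_real x) ^ m)"
  by (rule meas.integrable_continuous_on_msupport[OF cauchy_kernel_measurable])
    (use assms in \<open>fastforce simp: off_support_def intro!: continuous_intros\<close>)

lemma kernel_int_0: "kernel_int z 0 A p = of_real (pairing A p)"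
  by (simp add: kernel_int_def pairing_def del: poly_mult)

lemma kernel_int_add_right:
  assumes "off_support z"
  shows "kernel_int z m A (p + q) = kernel_int z m A p + kernel_int z m A q"
  unfolding kernel_int_def distrib_left poly_add of_real_add add_divide_distrib
  by (simp add: Bochner_Integration.integral_add[OF integrable_kernel[OF assms] integrable_kernel[OF assms]]
    sum.distrib del: poly_mult)

lemma kernel_int_smult_right:
  "kernel_int z m A (smult c p) = of_real c * kernel_int z m A p"
  by (simp add: kernel_int_def sum_distrib_left del: poly_mult flip: times_divide_eq_right)

lemma kernel_int_add_left:
  assumes "off_support z"
  shows "kernel_int z m (\<lambda>j. A j + B j) p = kernel_int z m A p + kernel_int z m B p"
  unfolding kernel_int_def distrib_right poly_add of_real_add add_divide_distrib
  by (simp add: Bochner_Integration.integral_add[OF integrable_kernel[OF assms] integrable_kernel[OF assms]]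
    sum.distrib del: poly_mult)

lemma kernel_int_smult_left:
  "kernel_int z m (\<lambda>j. smult c (A j)) p = of_real c * kernel_int z m A p"
  by (simp add: kernel_int_def sum_distrib_left del: poly_mult flip: times_divide_eq_right)

lemma kernel_int_sum_left:
  assumes "off_support z"
  shows "kernel_int z m (\<lambda>j. \<Sum>i\<in>I. A i j) p = (\<Sum>i\<in>I. kernel_int z m (A i) p)"
proof (induction I rule: infinite_finite_induct)
  case (insert i I)
  then show ?case using kernel_int_add_left[OF assms, of m "A i" "\<lambda>j. \<Sum>i\<in>I. A i j"] by simp
qed (simp_all add: kernel_int_def)

lemma kernel_int_pCons_left: "kernel_int z m (\<lambda>k. pCons 0 (A k)) p = kernel_int z m A (pCons 0 p)"
  by (simp add: kernel_int_def)

text \<open>Split z as (z - x) + x under the integral.\<close>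

lemma kernel_int_shift:
  assumes "off_support z"
  shows "z * kernel_int z (Suc m) A p = kernel_int z m A p + kernel_int z (Suc m) A (pCons 0 p)"
proof -
  have "z * (LINT x|\<mu> j. complex_of_real (poly (A j * p) x) / (z - complex_of_real x) ^ Suc m) =
    (LINT x|\<mu> j. complex_of_real (poly (A j * p) x) / (z - complex_of_real x) ^ m) +
    (LINT x|\<mu> j. complex_of_real (poly (A j * pCons 0 p) x) / (z - complex_of_real x) ^ Suc m)" for j
  proof -
    have "z * (LINT x|\<mu> j. complex_of_real (poly (A j * p) x) / (z - complex_of_real x) ^ Suc m) =
      (LINT x|\<mu> j. z * (complex_of_real (poly (A j * p) x) / (z - complex_of_real x) ^ Suc m))"
      by (simp only: integral_mult_right_zero)
    also have "\<dots> = (LINT x|\<mu> j. complex_of_real (poly (A j * p) x) / (z - complex_of_real x) ^ m +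
      complex_of_real (poly (A j * pCons 0 p) x) / (z - complex_of_real x) ^ Suc m)"
    proof (rule integral_cong_AE)
      show "AE x in \<mu> j. z * (complex_of_real (poly (A j * p) x) / (z - complex_of_real x) ^ Suc m) =
        complex_of_real (poly (A j * p) x) / (z - complex_of_real x) ^ m +
        complex_of_real (poly (A j * pCons 0 p) x) / (z - complex_of_real x) ^ Suc m"
        using meas.AE_msupport[of j]
      proof eventually_elim
        case (elim x)
        then have "z - complex_of_real x \<noteq> 0" using assms by (auto simp: off_support_def)
        then show ?case by (simp add: field_simps)
      qed
    qed (intro borel_measurable_times borel_measurable_add borel_measurable_const
        borel_measurable_integrable[OF integrable_kernel[OF assms]])+
    also have "\<dots> = (LINT x|\<mu> j. complex_of_real (poly (A j * p) x) / (z - complex_of_real x) ^ m) +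
      (LINT x|\<mu> j. complex_of_real (poly (A j * pCons 0 p) x) / (z - complex_of_real x) ^ Suc m)"
      by (rule Bochner_Integration.integral_add) (rule integrable_kernel[OF assms])+
    finally show ?thesis .
  qed
  then show ?thesis by (simp only: kernel_int_def sum_distrib_left sum.distrib)
qed

lemma pCons_split: "pCons a p = smult a 1 + pCons 0 (p :: real poly)"
  by simp

text \<open>The quotient (P(z) - P(x)) / (z - x) has degree at most M in x, so the form sees only
  its top coefficient. The point is that the last term, the price for the largest degree, is real.
  The induction is Horner's scheme.\<close>

lemma kernel_int_poly:
  assumes z: "off_support z" and low: "\<And>l. l < M \<Longrightarrow> pairing A (monom 1 l) = 0"
    and "degree P \<le> Suc M"
  shows "poly (map_poly complex_of_real P) z * kernel_int z 1 A 1 =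
    kernel_int z 1 A P + of_real (coeff P (Suc M) * pairing A (monom 1 M))"
  using assms(3)
proof (induction P)
  case 0
  then show ?case using kernel_int_smult_right[of z 1 A 0 1] by simp
next
  case (pCons a p)
  have deg: "degree p \<le> M" using pCons.prems pCons.hyps by (auto simp: degree_pCons_eq_if split: if_splits)
  then have IH: "poly (map_poly complex_of_real p) z * kernel_int z 1 A 1 = kernel_int z 1 A p"
    using pCons.IH by (simp add: coeff_eq_0)
  have "poly (map_poly complex_of_real (pCons a p)) z * kernel_int z 1 A 1 =
      of_real a * kernel_int z 1 A 1 + z * kernel_int z 1 A p"
    unfolding IH[symmetric] by (simp add: map_poly_pCons algebra_simps)
  also have "z * kernel_int z 1 A p = of_real (pairing A p) + kernel_int z 1 A (pCons 0 p)"
    using kernel_int_shift[OF z, of 0 A p] by (simp add: kernel_int_0 One_nat_def)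
  also have "pairing A p = coeff p M * pairing A (monom 1 M)"
    using low deg by (rule pairing_low_degree)
  also have "kernel_int z 1 A (pCons a p) = of_real a * kernel_int z 1 A 1 + kernel_int z 1 A (pCons 0 p)"
    unfolding pCons_split[of a p] kernel_int_add_right[OF z] kernel_int_smult_right ..
  ultimately show ?case by simp
qed

text \<open>One division by z - x gains one degree, provided the transform of the constant 1
  vanishes at z.\<close>

lemma kernel_int_vanish:
  assumes z: "off_support z" and low: "\<And>p. degree p \<le> N \<Longrightarrow> kernel_int z m A p = 0"
    and one: "kernel_int z (Suc m) A 1 = 0" and "degree P \<le> Suc N"
  shows "kernel_int z (Suc m) A P = 0"
  using assms(4)
proof (induction P)
  case 0
  then show ?case using kernel_int_smult_right[of z "Suc m" A 0 1] by simp
next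
  case (pCons a p)
  have deg: "degree p \<le> N" using pCons.prems pCons.hyps by (auto simp: degree_pCons_eq_if split: if_splits)
  then have "kernel_int z (Suc m) A (pCons 0 p) = 0"
    using kernel_int_shift[OF z, of m A p] low[OF deg] pCons.IH by simp
  then show ?case
    unfolding pCons_split[of a p] kernel_int_add_right[OF z] kernel_int_smult_right using one by simp
qed

lemma L_fun_eq: "L_fun \<mu> n z = kernel_int z 1 (mop_I \<mu> n) 1"
  by (simp add: L_fun_def kernel_int_def)

section \<open>Zeros of the functions of the second kind\<close>

text \<open>If the transform vanished, \<open>kernel_int_poly\<close> would make the transform of
  the sign-matching P real, whereas its imaginary part is - Im z times a positive sum. The bound on
  M keeps the degree of P at most M + 1.\<close>

lemma kernel_int_nonreal_nonzero:
  assumes adm: "admissible n A" and nz: "A i \<noteq> 0"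
    and low: "\<And>l. l < M \<Longrightarrow> pairing A (monom 1 l) = 0" and M: "msize n \<le> Suc (Suc M)"
    and z: "Im z \<noteq> 0"
  shows "kernel_int z 1 A 1 \<noteq> 0"
proof
  assume "kernel_int z 1 A 1 = 0"
  note off = off_support_nonreal[OF z]
  obtain P where P: "P \<noteq> 0" "degree P < msize n"
    "\<And>j x. x \<in> {lo j..hi j} \<Longrightarrow> poly (A j * P) x \<ge> 0"
    using sign_matching_poly[of n A, OF adm nz] by blast
  have "kernel_int z 1 A P = - of_real (coeff P (Suc M) * pairing A (monom 1 M))"
    using kernel_int_poly[of z M A P] off low P(2) M \<open>kernel_int z 1 A 1 = 0\<close>
    by (simp add: eq_neg_iff_add_eq_0)
  then have "Im (kernel_int z 1 A P) = 0" by simp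
  define w where "w x = 1 / (cmod (z - complex_of_real x))\<^sup>2" for x
  have Im_eq: "Im (complex_of_real t / (z - complex_of_real x)) = - Im z * (t * w x)" for t x
    by (simp add: Im_divide w_def cmod_power2)
  have int: "integrable (\<mu> j) (\<lambda>x. poly (A j * P) x * w x)" for j
  proof -
    have "integrable (\<mu> j) (\<lambda>x. Im (complex_of_real (poly (A j * P) x) / (z - complex_of_real x)))"
      using integrable_kernel[OF off, of j "A j * P" 1] by (simp del: poly_mult)
    then show ?thesis unfolding Im_eq using z by (simp del: poly_mult)
  qed
  have "Im (kernel_int z 1 A P) = (\<Sum>j\<in>UNIV. LINT x|\<mu> j. - Im z * (poly (A j * P) x * w x))"
    unfolding kernel_int_def Im_sum power_one_right Im_eq[symmetric]
    using integrable_kernel[OF off, of _ _ 1] by (simp del: poly_mult)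
  also have "\<dots> = - Im z * (\<Sum>j\<in>UNIV. LINT x|\<mu> j. poly (A j * P) x * w x)"
    by (simp add: sum_distrib_left sum_negf del: poly_mult)
  finally have "(\<Sum>j\<in>UNIV. LINT x|\<mu> j. poly (A j * P) x * w x) = 0"
    using \<open>Im (kernel_int z 1 A P) = 0\<close> z by simp
  moreover have "(\<Sum>j\<in>UNIV. LINT x|\<mu> j. poly (A j * P) x * w x) > 0"
  proof (rule weighted_pairing_pos[of A i P w, OF nz P(1) P(3)])
    fix j x assume "x \<in> msupport (\<mu> j)"
    then show "w x > 0" using off by (auto simp: w_def off_support_def)
  qed (use int in auto)
  ultimately show False by simp
qed

definition combo :: "(nat, 'd) vec \<Rightarrow> 'd \<Rightarrow> real \<Rightarrow> real \<Rightarrow> 'd \<Rightarrow> real poly" where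
  "combo n i \<alpha> \<beta> = (\<lambda>j. smult \<alpha> (mop_I \<mu> n j) + smult \<beta> (mop_I \<mu> (n + axis i 1) j))"

lemma kernel_int_combo:
  "off_support z \<Longrightarrow> kernel_int z m (combo n i \<alpha> \<beta>) p =
    of_real \<alpha> * kernel_int z m (mop_I \<mu> n) p + of_real \<beta> * kernel_int z m (mop_I \<mu> (n + axis i 1)) p"
  by (simp add: combo_def kernel_int_add_left kernel_int_smult_left)

text \<open>For the third part, the moment of order |n| - 1 returns \<alpha>, and once \<alpha> = 0,
  the one of order |n| returns \<beta>.\<close>

lemma combo_properties:
  assumes "msize n > 0"
  shows "admissible (n + axis i 1) (combo n i \<alpha> \<beta>)"
    and "l < msize n - 1 \<Longrightarrow> pairing (combo n i \<alpha> \<beta>) (monom 1 l) = 0"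
    and "\<alpha> \<noteq> 0 \<or> \<beta> \<noteq> 0 \<Longrightarrow> \<exists>j. combo n i \<alpha> \<beta> j \<noteq> 0"
proof -
  show "admissible (n + axis i 1) (combo n i \<alpha> \<beta>)"
    unfolding admissible_def
  proof (intro allI impI)
    fix j k assume k: "(n + axis i 1) $ j \<le> k"
    then have "n $ j \<le> k" by simp
    then show "coeff (combo n i \<alpha> \<beta> j) k = 0"
      using coeff_mop_I_ge[of n j k] coeff_mop_I_ge[of "n + axis i 1" j k] assms k
      by (simp add: combo_def msize_add_axis)
  qed
  have pair: "pairing (combo n i \<alpha> \<beta>) p = \<alpha> * pairing (mop_I \<mu> n) p + \<beta> * pairing (mop_I \<mu> (n + axis i 1)) p" for p
    by (simp add: combo_def pairing_add_left pairing_smult_left)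
  show "l < msize n - 1 \<Longrightarrow> pairing (combo n i \<alpha> \<beta>) (monom 1 l) = 0"
    by (auto simp: pair pairing_mop_I_monom msize_add_axis)
  show "\<exists>j. combo n i \<alpha> \<beta> j \<noteq> 0" if "\<alpha> \<noteq> 0 \<or> \<beta> \<noteq> 0"
  proof (rule ccontr)
    assume "\<not> ?thesis"
    then have 0: "pairing (combo n i \<alpha> \<beta>) p = 0" for p by (simp add: pairing_def)
    have "\<alpha> = 0"
      using 0[of "monom 1 (msize n - 1)"] assms unfolding pair
      by (simp add: pairing_mop_I_monom msize_add_axis)
    moreover from this have "\<beta> = 0"
      using 0[of "monom 1 (msize n)"] unfolding pair
      by (simp add: pairing_mop_I_monom msize_add_axis)
    ultimately show False using that by simp
  qed
qed

text \<open>The budget of \<open>kernel_int_nonreal_nonzero\<close> is met with equality: size |n| +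
  1 against |n| - 1 vanishing moments.\<close>

lemma L_fun_combination_nonzero:
  assumes "msize n > 0" "\<alpha> \<noteq> 0 \<or> \<beta> \<noteq> 0" "Im z \<noteq> 0"
  shows "of_real \<alpha> * L_fun \<mu> n z + of_real \<beta> * L_fun \<mu> (n + axis i 1) z \<noteq> 0"
proof -
  obtain j where "combo n i \<alpha> \<beta> j \<noteq> 0" using combo_properties(3) assms by blast
  then have "kernel_int z 1 (combo n i \<alpha> \<beta>) 1 \<noteq> 0"
    using kernel_int_nonreal_nonzero[where M = "msize n - 1", OF combo_properties(1)[OF assms(1), of i \<alpha> \<beta>]]
      combo_properties(2)[OF assms(1), of _ i \<alpha> \<beta>] assms
    by (simp add: msize_add_axis)
  then show ?thesis
    by (simp add: kernel_int_combo[OF off_support_nonreal[OF assms(3)]] L_fun_eq)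
qed

text \<open>
  At a real point of a gap of the supports, a common zero of \<open>L\<^sub>n\<close> and \<open>L\<close> at \<open>n + e\<^sub>i\<close> would make some
  combination vanish to second order; dividing its form twice by \<open>z - x\<close> yields a form with
  too many vanishing moments for its number of sign changes.
\<close>

lemma L_fun_no_common_zero:
  assumes n: "msize n \<ge> 2" and z: "off_support z"
  shows "L_fun \<mu> n z \<noteq> 0 \<or> L_fun \<mu> (n + axis i 1) z \<noteq> 0"
proof (cases "Im z = 0")
  case False
  then show ?thesis using L_fun_combination_nonzero[of n 1 0 z i] n by auto
next
  case True
  define t where "t = Re z"
  have zt: "z = of_real t" using True by (simp add: t_def complex_eq_iff)
  have real: "kernel_int z m A p = of_real (\<Sum>j\<in>UNIV. LINT x|\<mu> j. poly (A j * p) x / (t - x) ^ m)" for m A p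
    unfolding kernel_int_def zt of_real_sum integral_complex_of_real[symmetric] by simp
  show ?thesis
  proof (rule ccontr)
    assume "\<not> ?thesis"
    then have L: "kernel_int z 1 (mop_I \<mu> n) 1 = 0" "kernel_int z 1 (mop_I \<mu> (n + axis i 1)) 1 = 0"
      by (simp_all add: L_fun_eq)
    obtain u v where uv: "kernel_int z 2 (mop_I \<mu> n) 1 = of_real u"
      "kernel_int z 2 (mop_I \<mu> (n + axis i 1)) 1 = of_real v" using real by blast
    \<comment> \<open>\<open>u\<close> and \<open>v\<close> are real because z is, so a real
      combination exists whose transform of order 2 vanishes as well.\<close>
    obtain \<alpha> \<beta> :: real where ab: "\<alpha> \<noteq> 0 \<or> \<beta> \<noteq> 0" "\<alpha> * u + \<beta> * v = 0"
    proof (cases "u = 0 \<and> v = 0")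
      case True
      then show thesis by (intro that[of 1 0]) auto
    next
      case False
      then show thesis by (intro that[of v "-u"]) auto
    qed
    define A where "A = combo n i \<alpha> \<beta>"
    have npos: "msize n > 0" using n by simp
    obtain k where k: "A k \<noteq> 0" using combo_properties(3)[OF npos ab(1)] A_def by blast
    have adm: "admissible (n + axis i 1) A" unfolding A_def by (rule combo_properties(1)[OF npos])
    have 1: "kernel_int z 1 A 1 = 0" using L by (simp add: A_def kernel_int_combo[OF z])
    have "kernel_int z 2 A 1 = of_real (\<alpha> * u + \<beta> * v)"
      by (simp add: A_def kernel_int_combo[OF z] uv)
    then have 2: "kernel_int z 2 A 1 = 0" by (simp add: ab)
    \<comment> \<open>The form annihilates degrees up to N; two divisions carry this to N + 2 = |n|,
      the largest degree possible for the sign-matching polynomial at n + e_i.\<close>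
    define N where "N = msize n - 2"
    have N: "msize n = Suc (Suc N)" using n by (simp add: N_def)
    have low: "kernel_int z 0 A p = 0" if "degree p \<le> N" for p
      using pairing_low_degree[of N A p] combo_properties(2)[OF npos, of _ i \<alpha> \<beta>] that N
      by (simp add: kernel_int_0 A_def)
    have low1: "kernel_int z 1 A p = 0" if "degree p \<le> Suc N" for p
      using kernel_int_vanish[of z N 0 A p, OF z low _ that] 1 by (simp add: One_nat_def)
    have low2: "kernel_int z 2 A p = 0" if "degree p \<le> Suc (Suc N)" for p
      using kernel_int_vanish[of z "Suc N" 1 A p, OF z low1 _ that] 2 by simp
    obtain P where P: "P \<noteq> 0" "degree P < msize (n + axis i 1)"
      "\<And>j x. x \<in> {lo j..hi j} \<Longrightarrow> poly (A j * P) x \<ge> 0"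
      using sign_matching_poly[of "n + axis i 1" A, OF adm k] by blast
    have "kernel_int z 2 A P = 0" using P(2) N by (intro low2) (simp add: msize_add_axis)
    then have "(\<Sum>j\<in>UNIV. LINT x|\<mu> j. poly (A j * P) x / (t - x) ^ 2) = 0"
      unfolding real of_real_eq_0_iff .
    moreover have "(\<Sum>j\<in>UNIV. LINT x|\<mu> j. poly (A j * P) x * (1 / (t - x) ^ 2)) > 0"
    proof (rule weighted_pairing_pos[of A k P, OF k P(1) P(3)])
      fix j x assume "x \<in> msupport (\<mu> j)"
      then have "t \<noteq> x" using z by (auto simp: off_support_def zt)
      then show "1 / (t - x)\<^sup>2 > 0" by simp
    next
      fix j
      have "integrable (\<mu> j) (\<lambda>x. Re (complex_of_real (poly (A j * P) x) / (z - complex_of_real x) ^ 2))"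
        using integrable_kernel[OF z] by (rule integrable_Re)
      moreover have "complex_of_real (poly (A j * P) x) / (z - complex_of_real x) ^ 2
          = complex_of_real (poly (A j * P) x * (1 / (t - x) ^ 2))" for x
        by (simp add: zt)
      ultimately show "integrable (\<mu> j) (\<lambda>x. poly (A j * P) x * (1 / (t - x)\<^sup>2))"
        by (simp only: Re_complex_of_real)
    qed
    ultimately show False by (simp del: poly_mult)
  qed
qed

text \<open>Transform the recurrence of Q_n: z L_n and the transform of x Q_n differ by the integral
  of Q_n, which is 0 because |n| \<ge> 2.\<close>

lemma L_fun_recurrence:
  assumes pos: "\<And>k. n $ k > 0" and card: "CARD('d) \<ge> 2" and z: "off_support z"
  shows "z * L_fun \<mu> n z = L_fun \<mu> (n - axis j 1) z + of_real (b_coeff (n - axis j 1) j) * L_fun \<mu> n z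
    + (\<Sum>l\<in>UNIV. of_real (a_coeff n l) * L_fun \<mu> (n + axis l 1) z)"
proof -
  have "1 \<le> n $ k" for k using pos[of k] by linarith
  then have n: "2 \<le> msize n"
    using card sum_mono[of UNIV "\<lambda>_. 1" "\<lambda>k. n $ k"] by (simp add: msize_def)
  have "z * L_fun \<mu> n z = of_real (pairing (mop_I \<mu> n) 1) + kernel_int z 1 (mop_I \<mu> n) (pCons 0 1)"
    using kernel_int_shift[OF z, of 0 "mop_I \<mu> n" 1] by (simp add: L_fun_eq kernel_int_0 One_nat_def)
  also have "pairing (mop_I \<mu> n) 1 = 0"
    using pairing_mop_I_monom[of 0 n] n by (simp add: monom_0 one_pCons)
  also have "kernel_int z 1 (mop_I \<mu> n) (pCons 0 1) = kernel_int z 1 (\<lambda>k. pCons 0 (mop_I \<mu> n k)) 1"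
    by (simp only: kernel_int_pCons_left)
  also have "\<dots> = kernel_int z 1 (\<lambda>k. mop_I \<mu> (n - axis j 1) k + smult (b_coeff (n - axis j 1) j) (mop_I \<mu> n k)
    + (\<Sum>l\<in>UNIV. smult (a_coeff n l) (mop_I \<mu> (n + axis l 1) k))) 1"
    by (subst mop_I_recurrence[OF pos card, where j = j]) (rule refl)
  finally show ?thesis
    by (simp add: kernel_int_add_left[OF z] kernel_int_sum_left[OF z] kernel_int_smult_left L_fun_eq)
qed

section \<open>Continuity, conjugation symmetry and behaviour at infinity\<close>

lemma isCont_L_fun: "off_support z \<Longrightarrow> isCont (L_fun \<mu> n) z"
  unfolding L_fun_def off_support_def
  by (intro continuous_intros meas.isCont_cauchy) auto

lemma L_fun_cnj: "L_fun \<mu> n (cnj z) = cnj (L_fun \<mu> n z)"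
  unfolding L_fun_def cnj_sum
proof (rule sum.cong[OF refl])
  fix j
  have "cnj (complex_of_real a / (z - complex_of_real x)) = complex_of_real a / (cnj z - complex_of_real x)" for a x
    by simp
  then show "(LINT x|\<mu> j. complex_of_real (poly (mop_I \<mu> n j) x) / (cnj z - complex_of_real x)) =
      cnj (LINT x|\<mu> j. complex_of_real (poly (mop_I \<mu> n j) x) / (z - complex_of_real x))"
    unfolding Bochner_Integration.integral_cnj[symmetric] by (simp only:)
qed

lemma kernel_int_vertical_tendsto_0:
  "((\<lambda>y. kernel_int (Complex x y) 1 A p) \<longlongrightarrow> 0) at_top"
proof (rule Lim_null_comparison)
  let ?C = "\<Sum>j\<in>UNIV. LINT t|\<mu> j. \<bar>poly (A j * p) t\<bar>"
  show "((\<lambda>y. ?C / y) \<longlongrightarrow> 0) at_top"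
    by (intro tendsto_divide_0[OF tendsto_const]) (simp add: filterlim_at_top_imp_at_infinity filterlim_ident)
  show "\<forall>\<^sub>F y in at_top. norm (kernel_int (Complex x y) 1 A p) \<le> ?C / y"
    using eventually_gt_at_top[of 0]
  proof eventually_elim
    case (elim y)
    have "norm (LINT t|\<mu> j. complex_of_real (poly (A j * p) t) / (Complex x y - complex_of_real t) ^ 1)
        \<le> (LINT t|\<mu> j. \<bar>poly (A j * p) t\<bar>) / y" for j
    proof -
      have "norm (LINT t|\<mu> j. complex_of_real (poly (A j * p) t) / (Complex x y - complex_of_real t) ^ 1)
        \<le> (LINT t|\<mu> j. \<bar>poly (A j * p) t\<bar> / y)"
      proof (rule order_trans[OF integral_norm_bound integral_mono])
        show "integrable (\<mu> j) (\<lambda>t. norm (complex_of_real (poly (A j * p) t) / (Complex x y - complex_of_real t) ^ 1))"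
          using elim by (intro integrable_norm integrable_kernel off_support_nonreal) simp
        show "integrable (\<mu> j) (\<lambda>t. \<bar>poly (A j * p) t\<bar> / y)"
          by (intro integrable_divide integrable_abs integrable_poly')
        fix t
        have "y \<le> cmod (Complex x y - complex_of_real t)"
          using abs_Im_le_cmod[of "Complex x y - complex_of_real t"] elim by simp
        then have "\<bar>poly (A j * p) t\<bar> / cmod (Complex x y - complex_of_real t) \<le> \<bar>poly (A j * p) t\<bar> / y"
          using elim by (intro divide_left_mono mult_pos_pos) auto
        then show "norm (complex_of_real (poly (A j * p) t) / (Complex x y - complex_of_real t) ^ 1)
            \<le> \<bar>poly (A j * p) t\<bar> / y"
          by (simp only: norm_divide power_one_right norm_of_real)
      qed
      then show ?thesis by (simp only: integral_divide_zero)
    qed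
    then show ?case
      unfolding kernel_int_def sum_divide_distrib by (rule order_trans[OF norm_sum sum_mono])
  qed
qed

text \<open>The first nonzero moment of Q_n has order |n| - 1 and equals 1. Thus
  \<open>kernel_int_poly\<close> with the monomial of degree |n| gives the constant 1 plus a
  transform that tends to 0.\<close>

lemma L_fun_vertical_asymptotics:
  assumes "msize n > 0"
  shows "((\<lambda>y. Complex x y ^ msize n * L_fun \<mu> n (Complex x y)) \<longlongrightarrow> 1) at_top"
proof -
  obtain M where M: "msize n = Suc M" using assms by (cases "msize n") auto
  have "((\<lambda>y. kernel_int (Complex x y) 1 (mop_I \<mu> n) (monom 1 (Suc M)) + 1) \<longlongrightarrow> 0 + 1) at_top"
    by (intro tendsto_add kernel_int_vertical_tendsto_0 tendsto_const)
  moreover have "\<forall>\<^sub>F y in at_top. kernel_int (Complex x y) 1 (mop_I \<mu> n) (monom 1 (Suc M)) + 1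
      = Complex x y ^ msize n * L_fun \<mu> n (Complex x y)"
    using eventually_gt_at_top[of 0]
  proof eventually_elim
    case (elim y)
    have "off_support (Complex x y)" using elim by (intro off_support_nonreal) simp
    then show ?case
      using kernel_int_poly[of "Complex x y" M "mop_I \<mu> n" "monom 1 (Suc M)"] M
      by (simp add: pairing_mop_I_monom degree_monom_eq map_poly_monom poly_monom L_fun_eq)
  qed
  ultimately show ?thesis by (auto elim: Lim_transform_eventually)
qed

text \<open>
  \<open>Im (L' cnj L)\<close> has no zeros in the upper half-plane because no real combination of \<open>L\<close> and \<open>L'\<close>
  vanishes there; its sign is read off at infinity, where \<open>L' / L\<close> behaves like \<open>1 / z\<close>.
\<close>

lemma L_fun_ratio_sign:
  assumes n: "msize n > 0" and z: "Im z > 0"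
  shows "Im (L_fun \<mu> (n + axis i 1) z * cnj (L_fun \<mu> n z)) < 0"
proof (rule ccontr)
  let ?L = "L_fun \<mu> n" and ?L' = "L_fun \<mu> (n + axis i 1)" and ?N = "msize n"
  define Z where "Z y = Complex (Re z) y" for y
  define g where "g y = Im (?L' (Z y) * cnj (?L (Z y)))" for y
  assume "\<not> ?thesis"
  then have g0: "g (Im z) \<ge> 0" by (simp add: g_def Z_def)
  have nz: "g y \<noteq> 0" if y: "y > 0" for y
  proof
    assume g: "g y = 0"
    have Im: "Im (Z y) \<noteq> 0" using y by (simp add: Z_def)
    have L: "?L (Z y) \<noteq> 0" using L_fun_combination_nonzero[of n 1 0 "Z y" i] n Im by simp
    \<comment> \<open>A real product would make L' / L equal to the real number r, so L' - r L would
      be an excluded combination.\<close>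
    define r where "r = Re (?L' (Z y) * cnj (?L (Z y))) / (cmod (?L (Z y)))\<^sup>2"
    have "?L' (Z y) * cnj (?L (Z y)) = of_real r * (?L (Z y) * cnj (?L (Z y)))"
      using g L unfolding g_def r_def complex_norm_square[symmetric]
      by (simp add: complex_eq_iff)
    then have "?L' (Z y) = of_real r * ?L (Z y)" using L by (simp flip: mult.assoc)
    then show False using L_fun_combination_nonzero[of n "-r" 1 "Z y" i] n Im by simp
  qed
  have cont: "isCont g y" if "y > 0" for y
  proof -
    have Z: "isCont Z y" unfolding Z_def Complex_eq by (intro continuous_intros)
    have "off_support (Z y)" using that by (intro off_support_nonreal) (simp add: Z_def)
    then have "isCont (\<lambda>y. L_fun \<mu> m (Z y)) y" for m
      using isCont_o2[OF Z isCont_L_fun] by blast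
    then show ?thesis unfolding g_def by (intro isCont_Im isCont_mult isCont_cnj)
  qed
  define u where "u y = Z y ^ ?N * ?L (Z y)" for y
  define v where "v y = Z y ^ Suc ?N * ?L' (Z y)" for y
  \<comment> \<open>The last factor is the conjugate of \<open>Z y\<close> divided by y: it balances
    the powers of \<open>Z y\<close> and its conjugate, so that a positive multiple of g remains,
    and it tends to -i, so the limit is -1.\<close>
  have "((\<lambda>y. Im (v y * cnj (u y) * (of_real (Re z / y) - \<i>))) \<longlongrightarrow> Im (1 * cnj 1 * (of_real 0 - \<i>))) at_top"
  proof (intro tendsto_intros)
    show "(u \<longlongrightarrow> 1) at_top"
      unfolding u_def Z_def by (rule L_fun_vertical_asymptotics[OF n])
    show "(v \<longlongrightarrow> 1) at_top"
      unfolding v_def Z_def using L_fun_vertical_asymptotics[of "n + axis i 1" "Re z"]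
      by (simp only: msize_add_axis zero_less_Suc)
    show "((\<lambda>y. Re z / y) \<longlongrightarrow> 0) at_top"
      by (intro tendsto_divide_0[OF tendsto_const]) (simp add: filterlim_at_top_imp_at_infinity filterlim_ident)
  qed
  then have "\<forall>\<^sub>F y in at_top. Im (v y * cnj (u y) * (of_real (Re z / y) - \<i>)) < 0"
    by (rule order_tendstoD) simp
  then have "\<forall>\<^sub>F y in at_top. g y < 0"
    using eventually_gt_at_top[of 0]
  proof eventually_elim
    case (elim y)
    have Zy: "of_real (Re z / y) - \<i> = cnj (Z y) / of_real y"
      using elim by (simp add: Z_def complex_eq_iff)
    have "v y * cnj (u y) * (of_real (Re z / y) - \<i>)
        = (Z y * cnj (Z y)) ^ Suc ?N * (?L' (Z y) * cnj (?L (Z y))) / of_real y"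
      unfolding Zy by (simp add: u_def v_def power_mult_distrib mult_ac)
    also have "\<dots> = of_real (((cmod (Z y))\<^sup>2) ^ Suc ?N / y) * (?L' (Z y) * cnj (?L (Z y)))"
      by (simp add: complex_norm_square[symmetric] del: power_Suc)
    finally have "((cmod (Z y))\<^sup>2) ^ Suc ?N / y * g y < 0"
      using elim by (simp add: g_def Im_complex_of_real del: power_Suc complex_cnj_mult)
    moreover have "((cmod (Z y))\<^sup>2) ^ Suc ?N / y \<ge> 0" using elim by simp
    ultimately show ?case by (meson mult_nonneg_nonneg not_le)
  qed
  then obtain y where y: "y \<ge> Im z" "g y < 0"
    using eventually_conj[OF eventually_ge_at_top[of "Im z"]] eventually_happens by force
  then obtain y' where "Im z \<le> y'" "g y' = 0"
    using IVT2[of g y 0 "Im z"] g0 cont z by force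
  then show False using nz[of y'] z by simp
qed

end

section \<open>Square summability on the tree\<close>

lemma sum_lists_Suc:
  fixes g :: "'d::finite list \<Rightarrow> 'b::comm_monoid_add"
  shows "(\<Sum>Y | length Y = Suc N. g Y) = (\<Sum>Y | length Y = N. \<Sum>i\<in>UNIV. g (i # Y))"
proof -
  have "{Y :: 'd list. length Y = Suc N} = (\<lambda>(Y, i). i # Y) ` ({Y. length Y = N} \<times> UNIV)"
    by (auto simp: length_Suc_conv image_iff)
  moreover have "inj_on (\<lambda>(Y, i). i # Y) ({Y :: 'd list. length Y = N} \<times> UNIV)"
    by (auto simp: inj_on_def)
  ultimately have "(\<Sum>Y | length Y = Suc N. g Y) = (\<Sum>(Y, i)\<in>{Y. length Y = N} \<times> UNIV. g (i # Y))"
    by (simp add: sum.reindex split_def)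
  then show ?thesis by (simp add: sum.cartesian_product)
qed

lemma ell2_I:
  assumes "\<And>F. finite F \<Longrightarrow> (\<Sum>v\<in>F. (cmod (f v))\<^sup>2) \<le> B"
  shows "f \<in> ell2"
  unfolding ell2_def
  by (auto intro!: nonneg_bdd_above_summable_on bdd_aboveI2[where M = B] assms)

text \<open>
  Green's identity on the ball of radius \<open>N\<close>: the flux through its boundary has a sign, so it bounds
  \<open>Im z\<close> times the partial sums of squares by the contribution of the root.
\<close>

lemma tree_solution_in_ell2:
  fixes f :: "'d::finite list \<Rightarrow> complex" and v w :: "'d list \<Rightarrow> real"
  assumes z: "Im z > 0"
    and root: "of_real (v []) * f [] + (\<Sum>i\<in>UNIV. of_real (w [i]) * f [i]) = z * f [] + S"
    and node: "\<And>l Y. of_real (w (l # Y)) * f Y + of_real (v (l # Y)) * f (l # Y) +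
      (\<Sum>i\<in>UNIV. of_real (w (i # l # Y)) * f (i # l # Y)) = z * f (l # Y)"
    and sign: "\<And>i Y. w (i # Y) * Im (f (i # Y) * cnj (f Y)) \<le> 0"
  shows "f \<in> ell2"
proof -
  define \<phi> where "\<phi> i Y = w (i # Y) * Im (f (i # Y) * cnj (f Y))" for i Y
  define flux where "flux N = (\<Sum>Y | length Y = N. \<Sum>i\<in>UNIV. \<phi> i Y)" for N
  define E where "E Y = (cmod (f Y))\<^sup>2" for Y
  have ImE: "Im (z * f Y * cnj (f Y)) = Im z * E Y" for Y
    by (simp add: E_def cmod_power2) (simp add: power2_eq_square algebra_simps)
  have Imv: "Im (of_real (v Y) * f Y * cnj (f Y)) = 0" for Y
    by (simp add: mult.assoc flip: complex_norm_square)
  have Imw: "Im ((\<Sum>i\<in>UNIV. of_real (w (i # Y)) * f (i # Y)) * cnj (f Y)) = (\<Sum>i\<in>UNIV. \<phi> i Y)" for Y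
  proof -
    have scale: "Im (complex_of_real a * x) = a * Im x" for a x by simp
    show ?thesis by (simp only: sum_distrib_right mult.assoc \<phi>_def Im_sum scale)
  qed
  have flip: "Im (of_real (w (l # Y)) * f Y * cnj (f (l # Y))) = - \<phi> l Y" for l Y
    by (simp add: \<phi>_def algebra_simps)
  have E_root: "Im z * E [] = (\<Sum>i\<in>UNIV. \<phi> i []) - Im (S * cnj (f []))"
  proof -
    have "Im ((of_real (v []) * f [] + (\<Sum>i\<in>UNIV. of_real (w [i]) * f [i])) * cnj (f []))
      = Im ((z * f [] + S) * cnj (f []))" by (simp only: root)
    then show ?thesis by (simp only: distrib_right plus_complex.sel Imv Imw ImE)
  qed
  have E_node: "Im z * E (l # Y) = (\<Sum>i\<in>UNIV. \<phi> i (l # Y)) - \<phi> l Y" for l Y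
  proof -
    have "Im ((of_real (w (l # Y)) * f Y + of_real (v (l # Y)) * f (l # Y) +
      (\<Sum>i\<in>UNIV. of_real (w (i # l # Y)) * f (i # l # Y))) * cnj (f (l # Y)))
      = Im (z * f (l # Y) * cnj (f (l # Y)))" by (simp only: node)
    then show ?thesis by (simp only: distrib_right plus_complex.sel Imv Imw ImE flip)
  qed
  \<comment> \<open>Flux entering a vertex is what its parent sends along that edge, so summation
    over levels telescopes.\<close>
  have balance: "Im z * (\<Sum>n\<le>N. \<Sum>Y | length Y = n. E Y) = flux N - Im (S * cnj (f []))" for N
  proof (induction N)
    case 0
    then show ?case using E_root by (simp add: flux_def)
  next
    case (Suc N)
    have "Im z * (\<Sum>Y | length Y = Suc N. E Y) = (\<Sum>Y | length Y = N. \<Sum>l\<in>UNIV. Im z * E (l # Y))"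
      by (simp add: sum_lists_Suc sum_distrib_left)
    also have "\<dots> = flux (Suc N) - flux N"
      by (simp add: E_node sum_subtractf flux_def sum_lists_Suc)
    finally show ?case using Suc by (simp add: distrib_left)
  qed
  have "(\<Sum>Y\<in>F. (cmod (f Y))\<^sup>2) \<le> - Im (S * cnj (f [])) / Im z" if F: "finite F" for F
  proof -
    obtain N where N: "\<And>Y. Y \<in> F \<Longrightarrow> length Y \<le> N"
      using finite_nat_set_iff_bounded_le[of "length ` F"] F by auto
    have fin: "finite {Y :: 'd list. length Y = n}" for n
      using finite_lists_length_eq[of "UNIV :: 'd set" n] by simp
    have "(\<Sum>Y\<in>F. E Y) \<le> (\<Sum>Y\<in>(\<Union>n\<le>N. {Y. length Y = n}). E Y)"
      by (rule sum_mono2) (use N fin in \<open>auto simp: E_def\<close>)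
    also have "\<dots> = (\<Sum>n\<le>N. \<Sum>Y | length Y = n. E Y)"
      by (rule sum.UNION_disjoint) (use fin in auto)
    finally have "Im z * (\<Sum>Y\<in>F. E Y) \<le> flux N - Im (S * cnj (f []))"
      unfolding balance[symmetric] using z by (intro mult_left_mono) auto
    moreover have "flux N \<le> 0"
      unfolding flux_def \<phi>_def by (intro sum_nonpos) (rule sign)
    ultimately show ?thesis using z by (simp add: E_def field_simps)
  qed
  then show ?thesis by (rule ell2_I)
qed

section \<open>Norm estimates, point masses and the resolvent\<close>

lemma ell2_norm_square: "(ell2_norm f)\<^sup>2 = (\<Sum>\<^sub>\<infinity>v. (cmod (f v))\<^sup>2)"
  by (simp add: ell2_norm_def infsum_nonneg)

lemma finite_sum_le_ell2_norm:
  assumes "f \<in> ell2" "finite F"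
  shows "(\<Sum>v\<in>F. (cmod (f v))\<^sup>2) \<le> (ell2_norm f)\<^sup>2"
  unfolding ell2_norm_square
  by (rule finite_sum_le_infsum) (use assms in \<open>auto simp: ell2_def\<close>)

lemma ell2_delta_sum: "((\<lambda>v. (cmod (ell2_delta X v))\<^sup>2) has_sum 1) UNIV"
proof -
  have "((\<lambda>v. (cmod (ell2_delta X v))\<^sup>2) has_sum (\<Sum>v\<in>{X}. (cmod (ell2_delta X v))\<^sup>2)) UNIV"
    by (rule has_sum_finite_neutralI[where B = "{X}"]) (auto simp: ell2_delta_def)
  then show ?thesis by (simp add: ell2_delta_def)
qed

lemma ell2_delta_in_ell2: "ell2_delta X \<in> ell2"
  using ell2_delta_sum[of X] by (auto simp: ell2_def summable_on_def)

lemma ell2_scale: "f \<in> ell2 \<Longrightarrow> (\<lambda>v. c * f v) \<in> ell2"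
  by (simp add: ell2_def norm_mult power_mult_distrib summable_on_cmult_right)

text \<open>From (a + b)^2 \<le> 2 a^2 + 2 b^2; the squared form is the one absorbed in
  \<open>ell2_pointwise_limit\<close>.\<close>

lemma ell2_norm_combination_delta:
  assumes "f \<in> ell2"
  shows "(ell2_norm (\<lambda>v. c * f v + s * ell2_delta X v))\<^sup>2 \<le> 2 * (cmod c)\<^sup>2 * (ell2_norm f)\<^sup>2 + 2 * (cmod s)\<^sup>2"
proof -
  let ?h = "\<lambda>v. 2 * (cmod c)\<^sup>2 * (cmod (f v))\<^sup>2 + 2 * (cmod s)\<^sup>2 * (cmod (ell2_delta X v))\<^sup>2"
  have sum: "(?h has_sum (2 * (cmod c)\<^sup>2 * (ell2_norm f)\<^sup>2 + 2 * (cmod s)\<^sup>2 * 1)) UNIV"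
    unfolding ell2_norm_square
    by (intro has_sum_add has_sum_cmult_right ell2_delta_sum has_sum_infsum) (use assms in \<open>simp add: ell2_def\<close>)
  have le: "(cmod (c * f v + s * ell2_delta X v))\<^sup>2 \<le> ?h v" for v
  proof -
    have "(cmod (c * f v + s * ell2_delta X v))\<^sup>2 \<le> (cmod (c * f v) + cmod (s * ell2_delta X v))\<^sup>2"
      by (intro power_mono norm_triangle_ineq) simp
    also have "\<dots> \<le> 2 * (cmod (c * f v))\<^sup>2 + 2 * (cmod (s * ell2_delta X v))\<^sup>2"
      using sum_squares_bound[of "cmod (c * f v)" "cmod (s * ell2_delta X v)"]
      by (simp add: power2_sum)
    finally show ?thesis by (simp add: norm_mult power_mult_distrib mult.assoc)
  qed
  have "(ell2_norm (\<lambda>v. c * f v + s * ell2_delta X v))\<^sup>2 \<le> (\<Sum>\<^sub>\<infinity>v. ?h v)"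
    unfolding ell2_norm_square
  proof (rule infsum_mono)
    show h: "?h summable_on UNIV" using sum by (auto simp: summable_on_def)
    show "(\<lambda>v. (cmod (c * f v + s * ell2_delta X v))\<^sup>2) summable_on UNIV"
      by (rule summable_on_comparison_test[OF h]) (use le in auto)
  qed (rule le)
  also have "\<dots> = 2 * (cmod c)\<^sup>2 * (ell2_norm f)\<^sup>2 + 2 * (cmod s)\<^sup>2"
    using infsumI[OF sum] by simp
  finally show ?thesis .
qed

lemma ell2_inner_delta: "ell2_inner f (ell2_delta Y) = f Y"
proof -
  have "((\<lambda>v. f v * cnj (ell2_delta Y v)) has_sum (\<Sum>v\<in>{Y}. f v * cnj (ell2_delta Y v))) UNIV"
    by (rule has_sum_finite_neutralI[where B = "{Y}"]) (auto simp: ell2_delta_def)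
  then show ?thesis by (simp add: ell2_inner_def ell2_delta_def infsumI)
qed

lemma not_in_spectrumD:
  assumes "z \<notin> ell2_spectrum T"
  shows "bij_betw (shift_op T z) ell2 ell2"
    and "\<exists>C\<ge>0. \<forall>f\<in>ell2. ell2_norm (resolvent T z f) \<le> C * ell2_norm f"
proof -
  show "bij_betw (shift_op T z) ell2 ell2" using assms by (simp add: ell2_spectrum_def)
  obtain C where C: "\<forall>f\<in>ell2. ell2_norm (resolvent T z f) \<le> C * ell2_norm f"
    using assms by (auto simp: ell2_spectrum_def)
  have "C * ell2_norm f \<le> max C 0 * ell2_norm f" for f :: "'a \<Rightarrow> complex"
    by (intro mult_right_mono) (auto simp: ell2_norm_def infsum_nonneg)
  then show "\<exists>C\<ge>0. \<forall>f\<in>ell2. ell2_norm (resolvent T z f) \<le> C * ell2_norm f"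
    using C by (intro exI[of _ "max C 0"]) (auto intro: order_trans)
qed

text \<open>
  \<open>T f\<^sub>k - z f\<^sub>k = (z\<^sub>k - z) f\<^sub>k + s\<^sub>k e\<^sub>X\<close>, so boundedness of \<open>(T - z)\<^sup>-\<^sup>1\<close> bounds the norms of \<open>f\<^sub>k\<close> as soon as
  \<open>z\<^sub>k\<close> is close to \<open>z\<close>, and the bound survives the pointwise limit.
\<close>

lemma ell2_pointwise_limit:
  fixes f :: "nat \<Rightarrow> 'v \<Rightarrow> complex"
  assumes z: "z \<notin> ell2_spectrum T"
    and f: "\<And>k. f k \<in> ell2" "\<And>k v. T (f k) v - zs k * f k v = s k * ell2_delta X v"
    and lim: "zs \<longlonglongrightarrow> z" "convergent s" "\<And>v. (\<lambda>k. f k v) \<longlonglongrightarrow> g v"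
  shows "g \<in> ell2"
proof -
  obtain C where C: "C \<ge> 0" "\<And>h. h \<in> ell2 \<Longrightarrow> ell2_norm (resolvent T z h) \<le> C * ell2_norm h"
    using not_in_spectrumD(2)[OF z] by blast
  note bij = not_in_spectrumD(1)[OF z]
  obtain B where B: "\<And>k. cmod (s k) \<le> B"
    using convergent_imp_Bseq[OF lim(2)] by (auto simp: Bseq_def)
  have "(\<lambda>k. 2 * C\<^sup>2 * (cmod (zs k - z))\<^sup>2) \<longlonglongrightarrow> 2 * C\<^sup>2 * (cmod (z - z))\<^sup>2"
    by (intro tendsto_intros lim)
  \<comment> \<open>With the threshold 1/2 the term containing \<open>ell2_norm (f k)\<close> is
    absorbed by the left side; doubling the rest produces the constant 4.\<close>
  then have ev: "\<forall>\<^sub>F k in sequentially. 2 * C\<^sup>2 * (cmod (zs k - z))\<^sup>2 < 1 / 2"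
    by (rule order_tendstoD) simp
  have bound: "\<forall>\<^sub>F k in sequentially. (ell2_norm (f k))\<^sup>2 \<le> 4 * C\<^sup>2 * B\<^sup>2"
    using ev
  proof eventually_elim
    case (elim k)
    let ?h = "\<lambda>v. (zs k - z) * f k v + s k * ell2_delta X v"
    have h: "shift_op T z (f k) = ?h"
      using f(2)[of k] by (auto simp: shift_op_def algebra_simps)
    have "?h \<in> ell2" using bij f(1)[of k] unfolding h[symmetric] by (rule bij_betwE[THEN bspec])
    moreover have "resolvent T z ?h = f k"
      unfolding resolvent_def h[symmetric] using bij f(1)[of k] by (simp add: bij_betw_def inv_into_f_f)
    ultimately have "ell2_norm (f k) \<le> C * ell2_norm ?h" using C(2) by metis
    then have "(ell2_norm (f k))\<^sup>2 \<le> (C * ell2_norm ?h)\<^sup>2"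
      by (rule power_mono) (simp add: ell2_norm_def infsum_nonneg)
    also have "\<dots> = C\<^sup>2 * (ell2_norm ?h)\<^sup>2" by (simp add: power_mult_distrib)
    also have "\<dots> \<le> C\<^sup>2 * (2 * (cmod (zs k - z))\<^sup>2 * (ell2_norm (f k))\<^sup>2 + 2 * (cmod (s k))\<^sup>2)"
      by (intro mult_left_mono ell2_norm_combination_delta f) simp
    also have "\<dots> = (2 * C\<^sup>2 * (cmod (zs k - z))\<^sup>2) * (ell2_norm (f k))\<^sup>2 + 2 * C\<^sup>2 * (cmod (s k))\<^sup>2"
      by (simp add: algebra_simps)
    also have "\<dots> \<le> 1 / 2 * (ell2_norm (f k))\<^sup>2 + 2 * C\<^sup>2 * B\<^sup>2"
      using elim B[of k] by (intro add_mono mult_right_mono mult_left_mono power_mono) auto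
    finally show ?case by simp
  qed
  show ?thesis
  proof (rule ell2_I)
    fix F :: "'v set" assume F: "finite F"
    have "(\<lambda>k. \<Sum>v\<in>F. (cmod (f k v))\<^sup>2) \<longlonglongrightarrow> (\<Sum>v\<in>F. (cmod (g v))\<^sup>2)"
      by (intro tendsto_intros lim)
    moreover have "\<forall>\<^sub>F k in sequentially. (\<Sum>v\<in>F. (cmod (f k v))\<^sup>2) \<le> 4 * C\<^sup>2 * B\<^sup>2"
      using bound by eventually_elim (rule order_trans[OF finite_sum_le_ell2_norm[OF f(1) F]])
    ultimately show "(\<Sum>v\<in>F. (cmod (g v))\<^sup>2) \<le> 4 * C\<^sup>2 * B\<^sup>2"
      by (rule tendsto_upperbound) simp
  qed
qed

section \<open>The Jacobi matrix and functions of the second kind\<close>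

lemma tree_proj_pos: "tree_proj Y $ k > 0"
  by (induction Y) auto

lemma msize_one: "msize (1 :: nat ^ 'd::finite) = CARD('d)"
  by (simp add: msize_def)

lemma m_const_Nil: "m_const \<mu> [] = 1"
  by (simp add: m_const_def)

lemma m_const_Cons: "m_const \<mu> (l # Y) = m_const \<mu> Y / sqrt (weight_W \<mu> (l # Y))"
proof -
  have "{y. suffix y (l # Y)} = insert (l # Y) {y. suffix y Y}"
    by (auto simp: suffix_Cons)
  moreover have "finite {y. suffix y Y}" by (simp flip: set_suffixes_eq)
  moreover have "\<not> suffix (l # Y) Y" by (auto dest: suffix_length_le)
  ultimately show ?thesis by (simp add: m_const_def)
qed

lemma l_fun_Nil: "l_fun \<mu> z [] = L_fun \<mu> 1 z"
  by (simp add: l_fun_def m_const_Nil)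

lemma l_fun_Cons:
  "l_fun \<mu> z (l # Y) = of_real (sqrt (weight_W \<mu> (l # Y))) * (L_fun \<mu> (tree_proj Y + axis l 1) z / of_real (m_const \<mu> Y))"
  by (simp add: l_fun_def m_const_Cons)

definition root_factor :: "('d::finite \<Rightarrow> real measure) \<Rightarrow> real ^ 'd \<Rightarrow> complex \<Rightarrow> complex" where
  "root_factor \<mu> \<kappa> z = (\<Sum>j\<in>UNIV. complex_of_real (gamma_const \<mu> \<kappa> j) * markov_fun (\<mu> j) z)"

context angelesco_system
begin

context
  fixes \<kappa> :: "(real, 'd) vec"
  assumes card: "CARD('d) \<ge> 2" and \<kappa>: "(\<Sum>j\<in>UNIV. \<kappa> $ j) = 1"
begin

lemma weight_W_pos: "weight_W \<mu> Y > 0"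
  by (cases Y) (simp_all add: rec_coeffs_eq a_coeff_pos tree_proj_pos)

lemma m_const_pos: "m_const \<mu> Y > 0"
  by (induction Y) (simp_all add: m_const_Nil m_const_Cons weight_W_pos del: weight_W.simps)

lemma msize_tree_proj: "msize (tree_proj (Y :: 'd list)) \<ge> 2"
  using card by (induction Y) (simp_all add: msize_one msize_add_axis)

section \<open>The equation for l(z) at the root and at the other vertices\<close>

text \<open>The recurrence at the root reaches the indices 1 - e_j, which belong to no vertex. Their
  entries are at most 1, so the type I polynomials are constants and L is a combination of Markov
  functions.\<close>

lemma root_factor_eq: "root_factor \<mu> \<kappa> z = - (\<Sum>j\<in>UNIV. of_real (\<kappa> $ j) * L_fun \<mu> (1 - axis j 1) z)"
proof -
  have mop: "mop_I \<mu> (1 - axis j 1) i = [:coeff (mop_I \<mu> (1 - axis j 1) i) 0:]" for i j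
  proof (rule poly_eqI)
    fix k
    have "Suc (msize (1 - axis j 1 :: (nat, 'd) vec)) = CARD('d)"
      using msize_diff_axis[of 1 j] by (simp add: msize_one)
    then have "coeff (mop_I \<mu> (1 - axis j 1) i) k = 0" if "k > 0"
      using that card by (intro coeff_mop_I_ge) (auto simp: axis_nth)
    then show "coeff (mop_I \<mu> (1 - axis j 1) i) k = coeff [:coeff (mop_I \<mu> (1 - axis j 1) i) 0:] k"
      by (cases k) auto
  qed
  have "L_fun \<mu> (1 - axis j 1) z = (\<Sum>i\<in>UNIV. of_real (coeff (mop_I \<mu> (1 - axis j 1) i) 0) * markov_fun (\<mu> i) z)" for j
    unfolding L_fun_def
  proof (rule sum.cong[OF refl])
    fix i
    define c where "c = coeff (mop_I \<mu> (1 - axis j 1) i) 0"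
    have "mop_I \<mu> (1 - axis j 1) i = [:c:]" unfolding c_def by (rule mop)
    then have "(LINT x|\<mu> i. complex_of_real (poly (mop_I \<mu> (1 - axis j 1) i) x) / (z - complex_of_real x))
        = (LINT x|\<mu> i. of_real c * (1 / (z - complex_of_real x)))"
      by simp
    then show "(LINT x|\<mu> i. complex_of_real (poly (mop_I \<mu> (1 - axis j 1) i) x) / (z - complex_of_real x))
        = of_real (coeff (mop_I \<mu> (1 - axis j 1) i) 0) * markov_fun (\<mu> i) z"
      unfolding markov_fun_def c_def[symmetric] integral_mult_right_zero .
  qed
  then have "(\<Sum>j\<in>UNIV. of_real (\<kappa> $ j) * L_fun \<mu> (1 - axis j 1) z) =
      (\<Sum>j\<in>UNIV. \<Sum>i\<in>UNIV. of_real (\<kappa> $ j) * (of_real (coeff (mop_I \<mu> (1 - axis j 1) i) 0) * markov_fun (\<mu> i) z))"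
    by (simp add: sum_distrib_left)
  also have "\<dots> = (\<Sum>i\<in>UNIV. \<Sum>j\<in>UNIV. of_real (\<kappa> $ j) * (of_real (coeff (mop_I \<mu> (1 - axis j 1) i) 0) * markov_fun (\<mu> i) z))"
    by (rule sum.swap)
  also have "\<dots> = - root_factor \<mu> \<kappa> z"
    by (simp add: root_factor_def gamma_const_def sum_distrib_right sum_negf mult.assoc)
  finally show ?thesis by simp
qed

lemma sqrt_weight_square:
  "complex_of_real (sqrt (weight_W \<mu> Y)) * complex_of_real (sqrt (weight_W \<mu> Y)) = of_real (weight_W \<mu> Y)"
  using weight_W_pos[of Y] by (simp add: less_imp_le flip: of_real_mult)

text \<open>One square root comes from the matrix and one from the ratio of consecutive
  \<open>m_const\<close>; their product is a. This is how the normalisation makes the recurrence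
  symmetric.\<close>

lemma children_sum:
  "(\<Sum>i\<in>UNIV. of_real (sqrt (weight_W \<mu> (i # Y))) * l_fun \<mu> z (i # Y)) =
    (\<Sum>i\<in>UNIV. of_real (a_coeff (tree_proj Y) i) * L_fun \<mu> (tree_proj Y + axis i 1) z) / of_real (m_const \<mu> Y)"
proof -
  have "of_real (sqrt (weight_W \<mu> (i # Y))) * l_fun \<mu> z (i # Y) =
      of_real (a_coeff (tree_proj Y) i) * L_fun \<mu> (tree_proj Y + axis i 1) z / of_real (m_const \<mu> Y)" for i
    unfolding l_fun_Cons mult.assoc[symmetric] sqrt_weight_square by (simp add: rec_coeffs_eq)
  then show ?thesis by (simp add: sum_divide_distrib)
qed

text \<open>The recurrences at the index 1 in all directions j are averaged with the weights
  \<kappa>, which sum to 1; the terms at 1 - e_j have no parent to go to and form the right-hand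
  side.\<close>

lemma jacobi_root:
  assumes "off_support z"
  shows "of_real (pot_V \<mu> \<kappa> []) * l_fun \<mu> z [] +
    (\<Sum>i\<in>UNIV. of_real (sqrt (weight_W \<mu> [i])) * l_fun \<mu> z [i]) = z * l_fun \<mu> z [] + root_factor \<mu> \<kappa> z"
proof -
  let ?A = "\<Sum>l\<in>UNIV. of_real (a_coeff 1 l) * L_fun \<mu> (1 + axis l 1) z"
  have "of_real (\<kappa> $ j) * (z * L_fun \<mu> 1 z) = of_real (\<kappa> $ j) * L_fun \<mu> (1 - axis j 1) z +
      of_real (\<kappa> $ j * b_coeff (1 - axis j 1) j) * L_fun \<mu> 1 z + of_real (\<kappa> $ j) * ?A" for j
    using L_fun_recurrence[of 1 z j] card assms by (simp add: algebra_simps)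
  then have "(\<Sum>j\<in>UNIV. of_real (\<kappa> $ j) * (z * L_fun \<mu> 1 z)) =
      (\<Sum>j\<in>UNIV. of_real (\<kappa> $ j) * L_fun \<mu> (1 - axis j 1) z) +
      of_real (pot_V \<mu> \<kappa> []) * L_fun \<mu> 1 z + (\<Sum>j\<in>UNIV. of_real (\<kappa> $ j)) * ?A"
    by (simp add: sum.distrib sum_distrib_right rec_coeffs_eq)
  moreover have "(\<Sum>j\<in>UNIV. complex_of_real (\<kappa> $ j)) = 1" using \<kappa> by (simp flip: of_real_sum)
  ultimately have "z * L_fun \<mu> 1 z = - root_factor \<mu> \<kappa> z + of_real (pot_V \<mu> \<kappa> []) * L_fun \<mu> 1 z + ?A"
    by (simp add: root_factor_eq flip: sum_distrib_right)
  then show ?thesis by (simp add: children_sum m_const_Nil l_fun_Nil del: pot_V.simps weight_W.simps)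
qed

text \<open>The recurrence is taken in the direction l of the edge to the parent, so that its lower
  neighbour is the index of the parent.\<close>

lemma jacobi_node:
  assumes "off_support z"
  shows "of_real (sqrt (weight_W \<mu> (l # Y))) * l_fun \<mu> z Y + of_real (pot_V \<mu> \<kappa> (l # Y)) * l_fun \<mu> z (l # Y) +
    (\<Sum>i\<in>UNIV. of_real (sqrt (weight_W \<mu> (i # l # Y))) * l_fun \<mu> z (i # l # Y)) = z * l_fun \<mu> z (l # Y)"
proof -
  let ?n = "tree_proj (l # Y)" and ?m = "complex_of_real (m_const \<mu> (l # Y))"
  have n: "?n - axis l 1 = tree_proj Y" by (simp add: vec_eq_iff)
  have "of_real (sqrt (weight_W \<mu> (l # Y))) * l_fun \<mu> z Y = L_fun \<mu> (tree_proj Y) z / ?m"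
    by (simp add: l_fun_def m_const_Cons)
  moreover have "z * L_fun \<mu> ?n z = L_fun \<mu> (tree_proj Y) z + of_real (pot_V \<mu> \<kappa> (l # Y)) * L_fun \<mu> ?n z
      + (\<Sum>i\<in>UNIV. of_real (a_coeff ?n i) * L_fun \<mu> (?n + axis i 1) z)"
    using L_fun_recurrence[OF tree_proj_pos card assms, of "l # Y" l] n by (simp add: rec_coeffs_eq)
  then have "z * L_fun \<mu> ?n z / ?m = L_fun \<mu> (tree_proj Y) z / ?m + of_real (pot_V \<mu> \<kappa> (l # Y)) * L_fun \<mu> ?n z / ?m
      + (\<Sum>i\<in>UNIV. of_real (a_coeff ?n i) * L_fun \<mu> (?n + axis i 1) z) / ?m"
    by (simp only: add_divide_distrib)
  ultimately show ?thesis
    unfolding children_sum by (simp add: l_fun_def del: pot_V.simps weight_W.simps tree_proj.simps)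
qed

lemma jacobi_l_fun:
  assumes "off_support z"
  shows "jacobi \<mu> \<kappa> (l_fun \<mu> z) Y - z * l_fun \<mu> z Y = root_factor \<mu> \<kappa> z * ell2_delta [] Y"
  using jacobi_root[OF assms] jacobi_node[OF assms]
  by (cases Y) (simp_all add: ell2_delta_def del: pot_V.simps weight_W.simps)

section \<open>Square summability of l(z) and the resolvent identity\<close>

lemma l_fun_cnj: "l_fun \<mu> (cnj z) Y = cnj (l_fun \<mu> z Y)"
  by (simp add: l_fun_def L_fun_cnj)

lemma l_fun_in_ell2_upper:
  assumes "Im z > 0"
  shows "l_fun \<mu> z \<in> ell2"
proof (rule tree_solution_in_ell2[OF assms jacobi_root jacobi_node])
  show "off_support z" "off_support z" using assms by (auto intro: off_support_nonreal)
  fix i Y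
  let ?L = "L_fun \<mu> (tree_proj Y) z" and ?L' = "L_fun \<mu> (tree_proj Y + axis i 1) z"
  let ?w = "sqrt (weight_W \<mu> (i # Y))" and ?m = "m_const \<mu> Y"
  have neg: "Im (?L' * cnj ?L) < 0"
    using msize_tree_proj[of Y] by (intro L_fun_ratio_sign assms) simp
  \<comment> \<open>Up to a positive factor the flux along an edge is the quantity of
    \<open>L_fun_ratio_sign\<close>.\<close>
  have "l_fun \<mu> z (i # Y) * cnj (l_fun \<mu> z Y) = of_real (?w / ?m\<^sup>2) * (?L' * cnj ?L)"
    by (simp add: l_fun_Cons) (simp add: l_fun_def power2_eq_square)
  then have eq: "Im (l_fun \<mu> z (i # Y) * cnj (l_fun \<mu> z Y)) = ?w / ?m\<^sup>2 * Im (?L' * cnj ?L)"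
    by (simp only: Im_complex_of_real Re_complex_of_real times_complex.sel)
  have w: "?w \<ge> 0" using weight_W_pos[of "i # Y"] by (simp add: less_imp_le del: weight_W.simps)
  show "?w * Im (l_fun \<mu> z (i # Y) * cnj (l_fun \<mu> z Y)) \<le> 0"
    unfolding eq by (intro mult_nonneg_nonpos divide_nonneg_nonneg w zero_le_power2 less_imp_le[OF neg])
qed

lemma l_fun_in_ell2_nonreal:
  assumes "Im z \<noteq> 0"
  shows "l_fun \<mu> z \<in> ell2"
proof (cases "Im z > 0")
  case False
  then have "l_fun \<mu> (cnj z) \<in> ell2" using assms by (intro l_fun_in_ell2_upper) simp
  then show ?thesis by (simp add: ell2_def l_fun_cnj)
qed (rule l_fun_in_ell2_upper)

lemma isCont_root_factor:
  assumes "off_support z"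
  shows "isCont (root_factor \<mu> \<kappa>) z"
proof -
  have "isCont (markov_fun (\<mu> j)) z" for j
    using meas.isCont_cauchy[of z j 1] assms by (simp add: off_support_def markov_fun_def[abs_def])
  then show ?thesis unfolding root_factor_def by (intro continuous_intros)
qed

lemma l_fun_in_ell2:
  assumes z: "off_support z" "z \<notin> ell2_spectrum (jacobi \<mu> \<kappa>)"
  shows "l_fun \<mu> z \<in> ell2"
proof (cases "Im z = 0")
  case True
  \<comment> \<open>A vertical approach keeps every point nonreal, where membership is already
    known.\<close>
  define zs where "zs k = z + \<i> * of_real (inverse (real (Suc k)))" for k
  have Im: "Im (zs k) \<noteq> 0" for k using True by (simp add: zs_def)
  have "zs \<longlonglongrightarrow> z + \<i> * of_real 0"
    unfolding zs_def by (intro tendsto_intros LIMSEQ_inverse_real_of_nat)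
  then have lim: "zs \<longlonglongrightarrow> z" by simp
  show ?thesis
  proof (rule ell2_pointwise_limit[OF z(2)])
    show "l_fun \<mu> (zs k) \<in> ell2" for k by (rule l_fun_in_ell2_nonreal[OF Im])
    show "jacobi \<mu> \<kappa> (l_fun \<mu> (zs k)) Y - zs k * l_fun \<mu> (zs k) Y = root_factor \<mu> \<kappa> (zs k) * ell2_delta [] Y" for k Y
      by (rule jacobi_l_fun[OF off_support_nonreal[OF Im]])
    show "convergent (\<lambda>k. root_factor \<mu> \<kappa> (zs k))"
      using isCont_tendsto_compose[OF isCont_root_factor[OF z(1)] lim] by (auto simp: convergent_def)
    show "(\<lambda>k. l_fun \<mu> (zs k) Y) \<longlonglongrightarrow> l_fun \<mu> z Y" for Y
      unfolding l_fun_def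
      by (intro tendsto_divide tendsto_const isCont_tendsto_compose[OF isCont_L_fun[OF z(1)] lim])
        (use m_const_pos[of Y] in simp)
  qed (rule lim)
qed (rule l_fun_in_ell2_nonreal)

text \<open>The values at the root and at any one child are nonzero multiples of two neighbouring
  L.\<close>

lemma l_fun_nonzero:
  assumes "off_support z"
  shows "\<exists>Y. l_fun \<mu> z Y \<noteq> 0"
proof -
  fix i :: 'd
  have "l_fun \<mu> z [i] = of_real (sqrt (weight_W \<mu> [i])) * L_fun \<mu> (1 + axis i 1) z"
    by (simp add: l_fun_Cons m_const_Nil)
  moreover have "weight_W \<mu> [i] \<noteq> 0" using weight_W_pos[of "[i]"] by simp
  moreover have "L_fun \<mu> 1 z \<noteq> 0 \<or> L_fun \<mu> (1 + axis i 1) z \<noteq> 0"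
    using card by (intro L_fun_no_common_zero assms) (simp add: msize_one)
  ultimately have "l_fun \<mu> z [] \<noteq> 0 \<or> l_fun \<mu> z [i] \<noteq> 0"
    by (simp add: l_fun_Nil del: weight_W.simps)
  then show ?thesis by blast
qed

lemma jacobi_scale: "jacobi \<mu> \<kappa> (\<lambda>Y. c * f Y) Y = c * jacobi \<mu> \<kappa> f Y"
  by (cases Y) (simp_all add: distrib_left sum_distrib_left mult.left_commute)

text \<open>J - z sends l(z) and S times the resolvent vector to the same multiple of
  \<open>ell2_delta []\<close>; both lie in \<open>ell2\<close>, where J - z is injective.\<close>

lemma resolvent_identity:
  assumes z: "off_support z" "z \<notin> ell2_spectrum (jacobi \<mu> \<kappa>)"
  shows "l_fun \<mu> z \<in> ell2"
    and "l_fun \<mu> z = (\<lambda>Y. root_factor \<mu> \<kappa> z * resolvent (jacobi \<mu> \<kappa>) z (ell2_delta []) Y)"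
    and "root_factor \<mu> \<kappa> z \<noteq> 0"
    and "green (jacobi \<mu> \<kappa>) Y [] z = inverse (root_factor \<mu> \<kappa> z) * l_fun \<mu> z Y"
proof -
  let ?T = "jacobi \<mu> \<kappa>" and ?S = "root_factor \<mu> \<kappa> z"
  define f where "f = resolvent ?T z (ell2_delta [])"
  note bij = not_in_spectrumD(1)[OF z(2)]
  show l: "l_fun \<mu> z \<in> ell2" by (rule l_fun_in_ell2[OF z])
  have img: "ell2_delta [] \<in> shift_op ?T z ` ell2"
    using bij ell2_delta_in_ell2[of "[]"] by (simp add: bij_betw_def)
  have f: "f \<in> ell2" "shift_op ?T z f = ell2_delta []"
    unfolding f_def resolvent_def by (rule inv_into_into[OF img], rule f_inv_into_f[OF img])
  have "shift_op ?T z (l_fun \<mu> z) = (\<lambda>Y. ?S * ell2_delta [] Y)"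
    by (simp add: shift_op_def jacobi_l_fun[OF z(1)])
  also have "\<dots> = shift_op ?T z (\<lambda>Y. ?S * f Y)"
    unfolding f(2)[symmetric] shift_op_def jacobi_scale by (simp add: algebra_simps)
  finally show eq: "l_fun \<mu> z = (\<lambda>Y. ?S * resolvent ?T z (ell2_delta []) Y)"
    unfolding f_def[symmetric] using bij l ell2_scale[OF f(1)] by (auto simp: bij_betw_def dest: inj_onD)
  show S: "?S \<noteq> 0" using l_fun_nonzero[OF z(1)] eq by (metis mult_zero_left)
  show "green ?T Y [] z = inverse ?S * l_fun \<mu> z Y"
    using S by (subst eq) (simp add: green_def ell2_inner_delta)
qed

end

end

section \<open>Passage from the definition of an Angelesco system to the theorem\<close>

lemma angelesco_imp_system:
  assumes "angelesco \<mu>"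
  obtains lo hi where "angelesco_system \<mu> lo hi"
proof -
  have A: "finite_measure (\<mu> i)" "sets (\<mu> i) = sets borel" "infinite (msupport (\<mu> i))"
    "\<exists>a b. convex hull (msupport (\<mu> i)) = {a..b}" for i
    using assms by (auto simp: angelesco_def)
  then obtain lo hi where hull: "\<And>i. convex hull (msupport (\<mu> i)) = {lo i..hi i}" by metis
  have sub: "msupport (\<mu> i) \<subseteq> {lo i..hi i}" for i
    using hull_subset[of "msupport (\<mu> i)" convex] hull by auto
  \<comment> \<open>Nonempty intervals contain their endpoints, at which the order of the hulls is
    then tested.\<close>
  have le: "lo i \<le> hi i" for i
  proof -
    have "msupport (\<mu> i) \<noteq> {}" using A(3)[of i] by auto
    then show ?thesis using sub[of i] by fastforce
  qed
  have "angelesco_system \<mu> lo hi"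
  proof (rule angelesco_system.intro)
    fix j
    show "compact_borel_measure (\<mu> j)"
      unfolding compact_borel_measure_def compact_borel_measure_axioms_def
      using A bounded_subset[OF bounded_closed_interval sub] by blast
    show "msupport (\<mu> j) \<subseteq> {lo j..hi j}" by (rule sub)
  next
    fix i j :: 'a assume "i < j"
    then have "\<forall>x\<in>{lo i..hi i}. \<forall>y\<in>{lo j..hi j}. x < y"
      using assms unfolding angelesco_def hull by blast
    moreover have "hi i \<in> {lo i..hi i}" "lo j \<in> {lo j..hi j}" using le by simp_all
    ultimately show "hi i < lo j" by blast
  qed
  then show thesis by (rule that)
qed

theorem proposition4p2:
  fixes \<mu> :: "'d::{finite,linorder} \<Rightarrow> real measure"
    and \<kappa> :: "real ^ ('d::{finite,linorder})"
  assumes "CARD('d) \<ge> 2"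
    and "angelesco \<mu>"
    and "(\<Sum>j\<in>UNIV. \<kappa> $ j) = 1"
  shows "\<forall>z. z \<notin> (\<Union>j. complex_of_real ` msupport (\<mu> j)) \<union> ell2_spectrum (jacobi \<mu> \<kappa>) \<longrightarrow>
    (let S = (\<Sum>j\<in>UNIV. complex_of_real (gamma_const \<mu> \<kappa> j) * markov_fun (\<mu> j) z) in
      l_fun \<mu> z \<in> ell2 \<and>
      l_fun \<mu> z = (\<lambda>Y. S * resolvent (jacobi \<mu> \<kappa>) z (ell2_delta []) Y) \<and>
      S \<noteq> 0 \<and>
      (\<forall>Y. green (jacobi \<mu> \<kappa>) Y [] z = inverse S * l_fun \<mu> z Y))"
proof (intro allI impI)
  fix z assume z: "z \<notin> (\<Union>j. complex_of_real ` msupport (\<mu> j)) \<union> ell2_spectrum (jacobi \<mu> \<kappa>)"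
  obtain lo hi where "angelesco_system \<mu> lo hi" using assms(2) by (rule angelesco_imp_system)
  then interpret angelesco_system \<mu> lo hi .
  have "off_support z" "z \<notin> ell2_spectrum (jacobi \<mu> \<kappa>)" using z by (auto simp: off_support_def)
  note res = resolvent_identity[OF assms(1,3) this]
  show "let S = (\<Sum>j\<in>UNIV. complex_of_real (gamma_const \<mu> \<kappa> j) * markov_fun (\<mu> j) z) in
      l_fun \<mu> z \<in> ell2 \<and>
      l_fun \<mu> z = (\<lambda>Y. S * resolvent (jacobi \<mu> \<kappa>) z (ell2_delta []) Y) \<and>
      S \<noteq> 0 \<and>
      (\<forall>Y. green (jacobi \<mu> \<kappa>) Y [] z = inverse S * l_fun \<mu> z Y)"
    unfolding Let_def root_factor_def[symmetric] using res by blast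
qed

end
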